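(* For any constant $c$, for any monotone DNF (resp. monotone CNF) $\varphi$ with arity and degree bounded by $c$, there is a d-SDNNF for $\varphi$ having size $|\varphi|\times 2^{O(\mathrm{tw}(\varphi))}$, and any d-SDNNF (resp. any SDNNF) for $\varphi$ has size $2^{\Omega(\mathrm{tw}(\varphi))}$. (The constants implicit in $O$ and $\Omega$ depend only on $c$, and the asymptotics are for $\mathrm{tw}(\varphi)$ large enough.)
   Context: A monotone DNF (resp. monotone CNF) on a finite set of variables $V$ is a disjunction of conjunctions (resp. conjunction of disjunctions) of variables of $V$; each such conjunction (resp. disjunction) is a clause, identified with the set of variables it contains. Monotone DNFs and CNFs are always assumed minimized (no clause is a subset of another) and to contain at least one non-empty clause. $|\varphi|$ is the size of the formula. The hypergraph of $\varphi$ has the variables as vertices and the clauses as hyperedges. The arity of $\varphi$ is the maximal size of a hyperedge; the degree is the maximal number of hyperedges containing a given vertex. $\mathrm{tw}(\varphi)$ is the treewidth of the hypergraph of $\varphi$: the minimal width of a tree decomposition, i.e. of a tree whose nodes (bags) are labeled by subsets of the vertices such that every hyperedge is contained in some bag and for each vertex the bags containing it form a connected subtree; width is the maximal bag size minus one. A Boolean circuit $C=(G,W,g_{\mathrm{output}},\mu)$ is a directed acyclic graph $(G,W)$ of gates and wires, with an output gate and a type in $\{\mathsf{var},\mathsf{not},\mathsf{or},\mathsf{and}\}$ for each gate; the inputs of $g$ are the gates $g'$ with $(g',g)\in W$; $\mathsf{not}$-gates have exactly one input and $\mathsf{var}$-gates none. The function captured by $C$ is the value of the output gate as a function of the valuation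 of the set $C_{\mathsf{var}}$ of variable gates; $C$ is a circuit for $\varphi$ if it captures the function of $\varphi$. The size of $C$ is that of the graph $(G,W)$. For a gate $g$, $\mathsf{Vars}(g)$ is the set of variable gates with a directed path to $g$. $C$ is in negation normal form (NNF) if inputs of $\mathsf{not}$-gates are variable gates. A v-tree over $V$ is a rooted ordered binary tree $T$ whose leaves are in bijection with $V$; $\mathsf{Leaves}(T_n)$ is the set of leaves of the subtree $T_n$ rooted at $n$. $T$ structures $C$ if $T$ is over $C_{\mathsf{var}}$ and for every $\mathsf{and}$-gate $g$ with inputs $g_1,\dots,g_m$, $m>0$, there is a node $n\in T$ with $m$ children $n_1,\dots,n_m$ such that $\mathsf{Vars}(g_i)\subseteq\mathsf{Leaves}(T_{n_i})$ for all $i$. An SDNNF is an NNF structured by some v-tree. $C$ is deterministic if for every $\mathsf{or}$-gate, no valuation makes two distinct inputs of it both evaluate to $1$. A d-SDNNF is a deterministic SDNNF. *)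

theory Defs
  imports
    "HOL-Library.Infinite_Typeclass"
    "Graph_Theory.Graph_Theory"
begin

section \<open>Hypergraphs and treewidth\<close>

text \<open>
  A hypergraph is given by its vertex set \<^term>\<open>V\<close> and its set \<^term>\<open>E\<close> of hyperedges.
\<close>

definition hyp_arity :: "'v set set \<Rightarrow> nat" where
  "hyp_arity E = Max (card ` E)"

definition hyp_degree :: "'v set \<Rightarrow> 'v set set \<Rightarrow> nat" where
  "hyp_degree V E = Max ((\<lambda>v. card {e \<in> E. v \<in> e}) ` V)"

text \<open>
  Undirected graphs are symmetric digraphs.  The constant \<^const>\<open>Digraph_Component.tree\<close> is not the
  notion needed here: it only forbids directed cycles, so it rejects every symmetric digraph
  with an edge and accepts, e.g., an acyclic orientation of a triangle.
\<close>

definition undirected_tree :: "'n pair_pre_digraph \<Rightarrow> bool" where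
  "undirected_tree T \<longleftrightarrow> pair_graph T \<and> pverts T \<noteq> {} \<and>
     (\<forall>s \<in> pverts T. \<forall>t \<in> pverts T. \<exists>!p. pre_digraph.apath (with_proj T) s p t)"

definition tree_decomposition ::
  "'v set \<Rightarrow> 'v set set \<Rightarrow> 'n pair_pre_digraph \<Rightarrow> ('n \<Rightarrow> 'v set) \<Rightarrow> bool" where
  "tree_decomposition V E T bag \<longleftrightarrow>
     undirected_tree T \<and>
     (\<forall>t \<in> pverts T. bag t \<subseteq> V) \<and>
     (\<forall>e \<in> E. \<exists>t \<in> pverts T. e \<subseteq> bag t) \<and>
     (\<forall>v \<in> V. Digraph_Component.connected (with_proj T \<restriction> {t \<in> pverts T. v \<in> bag t}))"

definition td_width :: "'n pair_pre_digraph \<Rightarrow> ('n \<Rightarrow> 'v set) \<Rightarrow> nat" where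
  "td_width T bag = Max ((\<lambda>t. card (bag t)) ` pverts T) - 1"

text \<open>As decomposition trees are finite, taking their nodes in \<^typ>\<open>nat\<close> is no restriction.\<close>

definition hyp_treewidth :: "'v set \<Rightarrow> 'v set set \<Rightarrow> nat" where
  "hyp_treewidth V E =
     (LEAST k. \<exists>(T :: nat pair_pre_digraph) bag. tree_decomposition V E T bag \<and> td_width T bag = k)"

text \<open>So the \<open>LEAST\<close> above is attained.\<close>

lemma undirected_tree_singleton: "undirected_tree \<lparr>pverts = {0::nat}, parcs = {}\<rparr>"
proof -
  interpret pair_graph "\<lparr>pverts = {0::nat}, parcs = {}\<rparr>"
    by unfold_locales (auto simp: symmetric_def sym_def)
  show ?thesis
    unfolding undirected_tree_def
    using pair_graph_axioms by (auto simp: apath_def awalk_def)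
qed

lemma tree_decomposition_exists:
  assumes "\<Union>E \<subseteq> V"
  shows "\<exists>(T :: nat pair_pre_digraph) bag. tree_decomposition V E T bag"
proof -
  let ?T = "\<lparr>pverts = {0::nat}, parcs = {}\<rparr>"
  have "tree_decomposition V E ?T (\<lambda>_. V)"
    using assms undirected_tree_singleton unfolding tree_decomposition_def
    by (auto simp: Digraph_Component.connected_def strongly_connected_def mk_symmetric_def reachable_def)
  then show ?thesis by blast
qed


section \<open>Monotone normal forms\<close>

text \<open>
  A monotone DNF or CNF is represented by its set of clauses; its variables are those that occur
  in some clause.  Which of the two is meant is decided by the function it is given:
  \<open>dnf_fun\<close> or \<open>cnf_fun\<close>.
\<close>

type_synonym 'v clauses = "'v set set"

definition monotone_nf :: "'v clauses \<Rightarrow> bool" where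
  "monotone_nf \<phi> \<longleftrightarrow> finite (\<Union>\<phi>) \<and>
     (\<forall>K \<in> \<phi>. \<forall>L \<in> \<phi>. K \<subseteq> L \<longrightarrow> K = L) \<and> (\<exists>K \<in> \<phi>. K \<noteq> {})"

definition dnf_fun :: "'v clauses \<Rightarrow> ('v \<Rightarrow> bool) \<Rightarrow> bool" where
  "dnf_fun \<phi> \<nu> \<longleftrightarrow> (\<exists>K \<in> \<phi>. \<forall>x \<in> K. \<nu> x)"

definition cnf_fun :: "'v clauses \<Rightarrow> ('v \<Rightarrow> bool) \<Rightarrow> bool" where
  "cnf_fun \<phi> \<nu> \<longleftrightarrow> (\<forall>K \<in> \<phi>. \<exists>x \<in> K. \<nu> x)"

text \<open>The size is the number of variable occurrences.\<close>

definition formula_size :: "'v clauses \<Rightarrow> nat" where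
  "formula_size \<phi> = (\<Sum>K \<in> \<phi>. card K)"

definition arity :: "'v clauses \<Rightarrow> nat" where
  "arity \<phi> = hyp_arity \<phi>"

definition degree :: "'v clauses \<Rightarrow> nat" where
  "degree \<phi> = hyp_degree (\<Union>\<phi>) \<phi>"

definition tw :: "'v clauses \<Rightarrow> nat" where
  "tw \<phi> = hyp_treewidth (\<Union>\<phi>) \<phi>"


section \<open>Boolean circuits\<close>

datatype gate_kind = VarGate | NotGate | OrGate | AndGate

record 'g circuit =
  gates :: "'g set"
  wires :: "('g \<times> 'g) set"
  output_gate :: 'g
  kind :: "'g \<Rightarrow> gate_kind"

definition inputs :: "'g circuit \<Rightarrow> 'g \<Rightarrow> 'g set" where
  "inputs C g = {g'. (g', g) \<in> wires C}"

definition var_gates :: "'g circuit \<Rightarrow> 'g set" where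
  "var_gates C = {g \<in> gates C. kind C g = VarGate}"

definition circuit :: "'g circuit \<Rightarrow> bool" where
  "circuit C \<longleftrightarrow>
     finite (gates C) \<and> wires C \<subseteq> gates C \<times> gates C \<and> acyclic (wires C) \<and>
     output_gate C \<in> gates C \<and>
     (\<forall>g \<in> gates C. kind C g = VarGate \<longrightarrow> inputs C g = {}) \<and>
     (\<forall>g \<in> gates C. kind C g = NotGate \<longrightarrow> card (inputs C g) = 1)"

text \<open>
  The value of a gate is defined by recursion along the wires; \<open>gate_value_unfold\<close> below
  is the recursion equation.  Only the values of \<^term>\<open>\<nu>\<close> on the variable gates matter.
\<close>

definition gate_value :: "'g circuit \<Rightarrow> ('g \<Rightarrow> bool) \<Rightarrow> 'g \<Rightarrow> bool" where
  "gate_value C \<nu> = wfrec (wires C) (\<lambda>val g.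
     case kind C g of
       VarGate \<Rightarrow> \<nu> g
     | NotGate \<Rightarrow> (\<forall>g' \<in> inputs C g. \<not> val g')
     | OrGate \<Rightarrow> (\<exists>g' \<in> inputs C g. val g')
     | AndGate \<Rightarrow> (\<forall>g' \<in> inputs C g. val g'))"

lemma gate_value_unfold:
  assumes "circuit C"
  shows "gate_value C \<nu> g = (case kind C g of
       VarGate \<Rightarrow> \<nu> g
     | NotGate \<Rightarrow> (\<forall>g' \<in> inputs C g. \<not> gate_value C \<nu> g')
     | OrGate \<Rightarrow> (\<exists>g' \<in> inputs C g. gate_value C \<nu> g')
     | AndGate \<Rightarrow> (\<forall>g' \<in> inputs C g. gate_value C \<nu> g'))"
proof -
  have "finite (wires C)" "acyclic (wires C)"
    using assms finite_subset[of "wires C" "gates C \<times> gates C"] by (auto simp: circuit_def)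
  then have wf: "wf (wires C)"
    by (rule finite_acyclic_wf)
  show ?thesis
    unfolding gate_value_def
    by (subst wfrec[OF wf]) (auto simp: cut_def inputs_def split: gate_kind.split)
qed

definition circuit_value :: "'g circuit \<Rightarrow> ('g \<Rightarrow> bool) \<Rightarrow> bool" where
  "circuit_value C \<nu> = gate_value C \<nu> (output_gate C)"

definition circuit_size :: "'g circuit \<Rightarrow> nat" where
  "circuit_size C = card (gates C) + card (wires C)"

text \<open>
  The variables of a formula are identified with the variable gates of a circuit for it.
\<close>

definition circuit_for_dnf :: "'g circuit \<Rightarrow> 'g clauses \<Rightarrow> bool" where
  "circuit_for_dnf C \<phi> \<longleftrightarrow>
     var_gates C = \<Union>\<phi> \<and> (\<forall>\<nu>. circuit_value C \<nu> = dnf_fun \<phi> \<nu>)"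

definition circuit_for_cnf :: "'g circuit \<Rightarrow> 'g clauses \<Rightarrow> bool" where
  "circuit_for_cnf C \<phi> \<longleftrightarrow>
     var_gates C = \<Union>\<phi> \<and> (\<forall>\<nu>. circuit_value C \<nu> = cnf_fun \<phi> \<nu>)"

definition Vars :: "'g circuit \<Rightarrow> 'g \<Rightarrow> 'g set" where
  "Vars C g = {x \<in> var_gates C. (x, g) \<in> (wires C)\<^sup>*}"

definition nnf :: "'g circuit \<Rightarrow> bool" where
  "nnf C \<longleftrightarrow> circuit C \<and>
     (\<forall>g \<in> gates C. kind C g = NotGate \<longrightarrow> inputs C g \<subseteq> var_gates C)"

definition deterministic :: "'g circuit \<Rightarrow> bool" where
  "deterministic C \<longleftrightarrow>
     (\<forall>g \<in> gates C. kind C g = OrGate \<longrightarrow>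
       (\<forall>g1 \<in> inputs C g. \<forall>g2 \<in> inputs C g. g1 \<noteq> g2 \<longrightarrow>
         \<not> (\<exists>\<nu>. gate_value C \<nu> g1 \<and> gate_value C \<nu> g2)))"


section \<open>V-trees and structuredness\<close>

text \<open>
  In a binary tree an internal node has one or two children, so and-gates with a single input
  can be structured.  A node is represented by the subtree rooted at it.
\<close>

datatype 'v vtree =
    VLeaf 'v
  | VNode1 "'v vtree"
  | VNode2 "'v vtree" "'v vtree"

primrec vtree_leaves :: "'v vtree \<Rightarrow> 'v list" where
  "vtree_leaves (VLeaf x) = [x]"
| "vtree_leaves (VNode1 t) = vtree_leaves t"
| "vtree_leaves (VNode2 t1 t2) = vtree_leaves t1 @ vtree_leaves t2"

primrec vtree_nodes :: "'v vtree \<Rightarrow> 'v vtree set" where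
  "vtree_nodes (VLeaf x) = {VLeaf x}"
| "vtree_nodes (VNode1 t) = insert (VNode1 t) (vtree_nodes t)"
| "vtree_nodes (VNode2 t1 t2) = insert (VNode2 t1 t2) (vtree_nodes t1 \<union> vtree_nodes t2)"

primrec vtree_children :: "'v vtree \<Rightarrow> 'v vtree list" where
  "vtree_children (VLeaf x) = []"
| "vtree_children (VNode1 t) = [t]"
| "vtree_children (VNode2 t1 t2) = [t1, t2]"

definition vtree_over :: "'v vtree \<Rightarrow> 'v set \<Rightarrow> bool" where
  "vtree_over T V \<longleftrightarrow> distinct (vtree_leaves T) \<and> set (vtree_leaves T) = V"

text \<open>The list \<^term>\<open>gs\<close> enumerates the inputs of the and-gate in an order of our choice.\<close>

definition structures :: "'g vtree \<Rightarrow> 'g circuit \<Rightarrow> bool" where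
  "structures T C \<longleftrightarrow> vtree_over T (var_gates C) \<and>
     (\<forall>g \<in> gates C. kind C g = AndGate \<and> inputs C g \<noteq> {} \<longrightarrow>
       (\<exists>gs. distinct gs \<and> set gs = inputs C g \<and>
         (\<exists>n \<in> vtree_nodes T. length (vtree_children n) = length gs \<and>
           (\<forall>i < length gs. Vars C (gs ! i) \<subseteq> set (vtree_leaves (vtree_children n ! i))))))"

definition sdnnf :: "'g circuit \<Rightarrow> bool" where
  "sdnnf C \<longleftrightarrow> nnf C \<and> (\<exists>T. structures T C)"

definition d_sdnnf :: "'g circuit \<Rightarrow> bool" where
  "d_sdnnf C \<longleftrightarrow> sdnnf C \<and> deterministic C"

end

(*
Upper bound. Rooting a tree decomposition and ordering the variables by their topmost bags gives an
elimination forest in which every variable v sees a bag B v of at most tw + 1 variables, itself and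
ancestors, and every clause lies in some B v. Deciding the variables from the roots down, with the
values in the current bag as state, is a deterministic decomposable circuit with O(2^tw) gates per
variable. Keeping a gate for each of the two possible answers makes the disjunction over the
children of a node deterministic, so that DNFs are handled like CNFs.

Lower bound. If every node of a v-tree cuts at most m clauses, then the variables of the clauses
that are cut around a node form the bags of a tree decomposition, so tw = O(m). As arity and degree are
bounded, some node cuts Omega(tw) clauses that are pairwise far apart, and restricting the other
variables leaves the (non-)disjointness function across this cut. An SDNNF covers its models by as many
rectangles as it has gates, and a fooling set shows that 2^Omega(tw) are needed for a CNF. A
d-SDNNF writes its function as a sum of products, so its size bounds the rank of the
communication matrix, which settles the DNF case.
*)

theory Submission
  imports Defs "HOL-Library.Function_Algebras"
begin

text \<open>Determinism is essential for the DNF lower bound. Conjoining the variables of each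
  clause along a v-tree, and taking the disjunction, is an SDNNF of linear size: every clause is a
  rectangle, so the models have a small cover. For a CNF it is the non-models that have a small
  cover. Both kinds of formula share one core, the event that some clause has all its variables
  equal to a truth value \<open>s\<close>. A DNF says that it happens for true, a CNF that it does
  not happen for false. Hence the upper bound is one construction with parameters \<open>s\<close>
  and a claimed answer \<open>q\<close>, and both lower bounds rest on one statement about
  restricted DNFs. Chosen clauses must be far apart because a clause that meets two of them could be
  satisfied by mixing them. A clause is near at most \<open>c ^ 4\<close> others, and turning cut
  clauses into bags costs one more factor \<open>c\<close>; together they give the fifth power in
  the exponent.\<close>

section \<open>Circuits from expressions\<close>

text \<open>
  Constants are tagged with a variable: subexpressions for disjoint sets of variables are then
  distinct, so that their conjunction really is a gate with two inputs.
\<close>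

datatype 'v nexp =
    Var 'v
  | Neg 'v
  | Cst 'v bool
  | And "'v nexp" "'v nexp"
  | Or "'v nexp" "'v nexp"

primrec nexp_val :: "('v \<Rightarrow> bool) \<Rightarrow> 'v nexp \<Rightarrow> bool" where
  "nexp_val \<nu> (Var x) = \<nu> x"
| "nexp_val \<nu> (Neg x) = (\<not> \<nu> x)"
| "nexp_val \<nu> (Cst x b) = b"
| "nexp_val \<nu> (And e f) = (nexp_val \<nu> e \<and> nexp_val \<nu> f)"
| "nexp_val \<nu> (Or e f) = (nexp_val \<nu> e \<or> nexp_val \<nu> f)"

primrec nexp_args :: "'v nexp \<Rightarrow> 'v nexp set" where
  "nexp_args (Var x) = {}"
| "nexp_args (Neg x) = {Var x}"
| "nexp_args (Cst x b) = {}"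
| "nexp_args (And e f) = {e, f}"
| "nexp_args (Or e f) = {e, f}"

text \<open>A constant becomes a gate without inputs: the empty conjunction is true and the empty
  disjunction is false. Structuredness asks nothing of and-gates without inputs.\<close>

primrec nexp_kind :: "'v nexp \<Rightarrow> gate_kind" where
  "nexp_kind (Var x) = VarGate"
| "nexp_kind (Neg x) = NotGate"
| "nexp_kind (Cst x b) = (if b then AndGate else OrGate)"
| "nexp_kind (And e f) = AndGate"
| "nexp_kind (Or e f) = OrGate"

primrec nexp_vars :: "'v nexp \<Rightarrow> 'v set" where
  "nexp_vars (Var x) = {x}"
| "nexp_vars (Neg x) = {x}"
| "nexp_vars (Cst x b) = {}"
| "nexp_vars (And e f) = nexp_vars e \<union> nexp_vars f"
| "nexp_vars (Or e f) = nexp_vars e \<union> nexp_vars f"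

primrec subexps :: "'v nexp \<Rightarrow> 'v nexp set" where
  "subexps (Var x) = {Var x}"
| "subexps (Neg x) = {Neg x, Var x}"
| "subexps (Cst x b) = {Cst x b}"
| "subexps (And e f) = insert (And e f) (subexps e \<union> subexps f)"
| "subexps (Or e f) = insert (Or e f) (subexps e \<union> subexps f)"

lemma finite_subexps [simp]: "finite (subexps e)"
  by (induction e) auto

lemma subexps_refl [simp]: "e \<in> subexps e"
  by (cases e) auto

lemma nexp_args_subexps: "f \<in> subexps e \<Longrightarrow> nexp_args f \<subseteq> subexps e"
  by (induction e) auto

lemma nexp_vars_subexps: "f \<in> subexps e \<Longrightarrow> nexp_vars f \<subseteq> nexp_vars e"
  by (induction e) auto

lemma card_nexp_args_le: "card (nexp_args e) \<le> 2" and finite_nexp_args [simp]: "finite (nexp_args e)"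
  by (cases e; simp add: card_insert_if)+

primrec nexp_height :: "'v nexp \<Rightarrow> nat" where
  "nexp_height (Var x) = 0"
| "nexp_height (Neg x) = 1"
| "nexp_height (Cst x b) = 0"
| "nexp_height (And e f) = nexp_height e + nexp_height f + 1"
| "nexp_height (Or e f) = nexp_height e + nexp_height f + 1"

lemma nexp_args_height: "f \<in> nexp_args e \<Longrightarrow> nexp_height f < nexp_height e"
  by (cases e) auto

definition nexp_deterministic :: "'v nexp \<Rightarrow> bool" where
  "nexp_deterministic e \<longleftrightarrow>
     (\<forall>f g. Or f g \<in> subexps e \<and> f \<noteq> g \<longrightarrow> \<not> (\<exists>\<nu>. nexp_val \<nu> f \<and> nexp_val \<nu> g))"

text \<open>The node set \<open>N\<close> is a parameter because inductions over a forest keep the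
  v-tree of the whole forest while they pass to subforests.\<close>

definition nexp_structured :: "'v vtree set \<Rightarrow> 'v nexp \<Rightarrow> bool" where
  "nexp_structured N e \<longleftrightarrow>
     (\<forall>f g. And f g \<in> subexps e \<longrightarrow> f \<noteq> g \<and>
       (\<exists>t1 t2. VNode2 t1 t2 \<in> N \<and> nexp_vars f \<subseteq> set (vtree_leaves t1) \<and>
         nexp_vars g \<subseteq> set (vtree_leaves t2)))"

lemma acyclic_if_decreasing:
  fixes m :: "'a \<Rightarrow> nat"
  assumes "\<And>x y. (x, y) \<in> R \<Longrightarrow> m x < m y"
  shows "acyclic R"
proof -
  have "R \<subseteq> measure m" using assms by auto
  then show ?thesis by (meson wf_acyclic wf_measure wf_subset)
qed

text \<open>
  The circuit shares equal subexpressions, so its size is governed by their number.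
  Gates have to be elements of the type of the variables, whence the renaming \<open>h\<close>.
\<close>

lemma exists_d_sdnnf_of_nexp:
  fixes e :: "'v::infinite nexp"
  assumes vars: "nexp_vars e \<subseteq> V" and fin: "finite V"
    and det: "nexp_deterministic e"
    and str: "nexp_structured (vtree_nodes T) e" and over: "vtree_over T V"
  shows "\<exists>C :: 'v circuit. d_sdnnf C \<and> var_gates C = V \<and>
    (\<forall>\<nu>. circuit_value C \<nu> = nexp_val \<nu> e) \<and>
    circuit_size C \<le> 3 * (card (subexps e) + card V)"
proof -
  \<comment> \<open>Variables of \<open>V\<close> that do not occur in \<open>e\<close> become
    isolated gates, since the variable gates have to be exactly \<open>V\<close>.\<close>
  define G where "G = subexps e \<union> Var ` V"
  have finG: "finite G" using fin by (simp add: G_def)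
  have args: "nexp_args f \<subseteq> G" if "f \<in> G" for f
    using that nexp_args_subexps[of f e] by (auto simp: G_def)
  have VarG: "Var x \<in> G \<longleftrightarrow> x \<in> V" for x
    using vars nexp_vars_subexps[of "Var x" e] by (auto simp: G_def)
  \<comment> \<open>\<open>h\<close> fixes the variables, which have to be their own gates. All
    other expressions get names outside \<open>V\<close>; there are enough of them because the type
    is infinite.\<close>
  obtain h where inj: "inj_on h G" and hV: "\<And>x. x \<in> V \<Longrightarrow> h (Var x) = x"
  proof -
    have "infinite (UNIV - V)" using fin by (simp add: infinite_UNIV)
    then obtain W where W: "W \<subseteq> UNIV - V" "finite W" "card W = card (G - Var ` V)"
      using infinite_arbitrarily_large by blast
    obtain k where k: "bij_betw k (G - Var ` V) W"
      using W finG by (metis bij_betw_iff_card finite_Diff)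
    define h where "h = (\<lambda>f. case f of Var x \<Rightarrow> if x \<in> V then x else k f | _ \<Rightarrow> k f)"
    have h1: "h (Var x) = x" if "x \<in> V" for x using that by (simp add: h_def)
    have h2: "h f = k f" if "f \<notin> Var ` V" for f
      using that by (auto simp: h_def split: nexp.split)
    have kW: "k f \<in> W" if "f \<in> G" "f \<notin> Var ` V" for f
      using k that by (auto simp: bij_betw_def)
    have "inj_on h G"
    proof (rule inj_onI)
      fix f g assume f: "f \<in> G" and g: "g \<in> G" and eq: "h f = h g"
      show "f = g"
      proof (cases "f \<in> Var ` V")
        case True
        then obtain x where x: "f = Var x" "x \<in> V" by auto
        show ?thesis
        proof (cases "g \<in> Var ` V")
          case True then show ?thesis using x eq h1 by auto
        next
          case False then show ?thesis using x eq h1 h2 kW[OF g] W by auto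
        qed
      next
        case False
        show ?thesis
        proof (cases "g \<in> Var ` V")
          case True then show ?thesis using False eq h1 h2 kW[OF f] W by auto
        next
          case gF: False
          then have "k f = k g" using False eq h2 by auto
          then show ?thesis using k f g False gF by (auto simp: bij_betw_def inj_on_def)
        qed
      qed
    qed
    with h1 that show thesis by blast
  qed
  have hinj: "h f = h g \<longleftrightarrow> f = g" if "f \<in> G" "g \<in> G" for f g
    using inj that by (auto simp: inj_on_def)
  define i where "i = inv_into G h"
  have ih: "i (h f) = f" if "f \<in> G" for f using inj that by (simp add: i_def)
  define C where "C = \<lparr>gates = h ` G, wires = (\<Union>f\<in>G. (\<lambda>g. (h g, h f)) ` nexp_args f),
    output_gate = h e, kind = (\<lambda>g. nexp_kind (i g))\<rparr>"
  have inp: "inputs C (h f) = h ` nexp_args f" if "f \<in> G" for f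
    using that hinj by (auto simp: inputs_def C_def)
  have kd: "kind C (h f) = nexp_kind f" if "f \<in> G" for f
    using that ih by (simp add: C_def)
  have gC: "gates C = h ` G" by (simp add: C_def)
  have eG: "e \<in> G" by (simp add: G_def)
  have vg: "var_gates C = V"
  proof -
    have "var_gates C = h ` {f \<in> G. nexp_kind f = VarGate}"
      using kd by (auto simp: var_gates_def gC)
    also have "{f \<in> G. nexp_kind f = VarGate} = Var ` V"
    proof -
      have "nexp_kind f = VarGate \<longleftrightarrow> (\<exists>x. f = Var x)" for f :: "'v nexp" by (cases f) auto
      then show ?thesis using VarG by auto
    qed
    also have "h ` Var ` V = V" using hV by (force simp: image_image)
    finally show ?thesis .
  qed
  have circ: "circuit C"
    unfolding circuit_def
  proof (intro conjI ballI impI)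
    show "finite (gates C)" using finG by (simp add: gC)
    show "wires C \<subseteq> gates C \<times> gates C" using args by (auto simp: C_def)
    show "acyclic (wires C)"
    proof (rule acyclic_if_decreasing[where m = "\<lambda>g. nexp_height (i g)"])
      fix x y assume "(x, y) \<in> wires C"
      then obtain f g where "f \<in> G" "g \<in> nexp_args f" "x = h g" "y = h f"
        by (auto simp: C_def)
      then show "nexp_height (i x) < nexp_height (i y)"
        using ih args[of f] nexp_args_height[of g f] by auto
    qed
    show "output_gate C \<in> gates C" using eG by (simp add: C_def)
  next
    fix g assume "g \<in> gates C" "kind C g = VarGate"
    then obtain f where f: "f \<in> G" "g = h f" "nexp_kind f = VarGate" using kd gC by auto
    then show "inputs C g = {}" using inp by (cases f) (auto split: if_splits)
  next
    fix g assume "g \<in> gates C" "kind C g = NotGate"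
    then obtain f where f: "f \<in> G" "g = h f" "nexp_kind f = NotGate" using kd gC by auto
    then show "card (inputs C g) = 1" using inp by (cases f) (auto split: if_splits)
  qed
  have val: "gate_value C \<nu> (h f) = nexp_val \<nu> f" if "f \<in> G" for f \<nu>
    using that
  proof (induction f)
    case (Var x)
    then show ?case using VarG hV kd[OF Var] by (subst gate_value_unfold[OF circ]) simp
  next
    case (Neg x)
    then show ?case using args[OF Neg] VarG[of x] hV[of x] kd[OF Neg] inp[OF Neg] kd[of "Var x"]
      by (subst gate_value_unfold[OF circ]) (simp, subst gate_value_unfold[OF circ], simp)
  next
    case (Cst x b)
    then show ?case using inp[OF Cst] kd[OF Cst] by (subst gate_value_unfold[OF circ]) (cases b; simp)
  next
    case (And f1 f2)
    then show ?case using args[of "And f1 f2"] inp[of "And f1 f2"] kd[of "And f1 f2"]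
      by (subst gate_value_unfold[OF circ]) simp
  next
    case (Or f1 f2)
    then show ?case using args[of "Or f1 f2"] inp[of "Or f1 f2"] kd[of "Or f1 f2"]
      by (subst gate_value_unfold[OF circ]) simp
  qed
  have pred: "x = h f \<or> (\<exists>g \<in> nexp_args f. (x, h g) \<in> (wires C)\<^sup>*)"
    if "f \<in> G" "(x, h f) \<in> (wires C)\<^sup>*" for x f
    using that(2)
  proof (cases rule: rtranclE)
    case (step y)
    then have "y \<in> inputs C (h f)" by (simp add: inputs_def)
    then show ?thesis using step inp[OF that(1)] by auto
  qed simp
  have VarsC: "Vars C (h f) \<subseteq> nexp_vars f" if "f \<in> G" for f
  proof -
    have "x \<in> nexp_vars f" if "f \<in> G" "(x, h f) \<in> (wires C)\<^sup>*" "x \<in> V" for x f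
      using that
    proof (induction f)
      case (Var y)
      then show ?case using pred[of "Var y" x] VarG hV by auto
    next
      case (Neg y)
      have "x = h (Var x)" "Var x \<in> G" using Neg hV VarG by auto
      then have "x \<noteq> h (Neg y)" using hinj[of "Var x" "Neg y"] Neg by auto
      then have "(x, h (Var y)) \<in> (wires C)\<^sup>*" "Var y \<in> G"
        using pred[OF Neg(1,2)] args[OF Neg(1)] by auto
      then show ?case using pred[of "Var y" x] VarG hV by auto
    next
      case (Cst y b)
      have "x = h (Var x)" "Var x \<in> G" using Cst hV VarG by auto
      then show ?case using hinj[of "Var x" "Cst y b"] Cst pred[of "Cst y b" x] by auto
    next
      case (And f1 f2)
      have "x = h (Var x)" "Var x \<in> G" using And hV VarG by auto
      then show ?case using hinj[of "Var x" "And f1 f2"] And pred[of "And f1 f2" x]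
        args[of "And f1 f2"] by auto
    next
      case (Or f1 f2)
      have "x = h (Var x)" "Var x \<in> G" using Or hV VarG by auto
      then show ?case using hinj[of "Var x" "Or f1 f2"] Or pred[of "Or f1 f2" x]
        args[of "Or f1 f2"] by auto
    qed
    then show ?thesis using that by (auto simp: Vars_def vg)
  qed
  have "nnf C"
    unfolding nnf_def
  proof (intro conjI ballI impI circ)
    fix g assume "g \<in> gates C" "kind C g = NotGate"
    then obtain f where f: "f \<in> G" "g = h f" "nexp_kind f = NotGate" using kd gC by auto
    then obtain x where x: "f = Neg x" by (cases f) (auto split: if_splits)
    then have "x \<in> V" using args[OF f(1)] VarG by auto
    then show "inputs C g \<subseteq> var_gates C" using inp[OF f(1)] f x hV vg by simp
  qed
  moreover have "deterministic C"
    unfolding deterministic_def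
  proof (intro ballI impI)
    fix g g1 g2
    assume "g \<in> gates C" "kind C g = OrGate" and g12: "g1 \<in> inputs C g" "g2 \<in> inputs C g" "g1 \<noteq> g2"
    then obtain f where f: "f \<in> G" "g = h f" "nexp_kind f = OrGate" using kd gC by auto
    then obtain f1 f2 where f12: "f = Or f1 f2" using g12 inp[OF f(1)]
      by (cases f) (auto split: if_splits)
    then have fG: "f1 \<in> G" "f2 \<in> G" using args[OF f(1)] by auto
    have ne: "f1 \<noteq> f2" using g12 inp[OF f(1)] f f12 by auto
    have "Or f1 f2 \<in> subexps e" using f f12 by (auto simp: G_def)
    then have "\<not> (\<exists>\<nu>. nexp_val \<nu> f1 \<and> nexp_val \<nu> f2)"
      using det ne by (auto simp: nexp_deterministic_def)
    then show "\<not> (\<exists>\<nu>. gate_value C \<nu> g1 \<and> gate_value C \<nu> g2)"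
      using g12 inp[OF f(1)] f f12 val fG by auto
  qed
  moreover have "structures T C"
    unfolding structures_def
  proof (intro conjI ballI impI)
    show "vtree_over T (var_gates C)" using over vg by simp
    fix g assume "g \<in> gates C" "kind C g = AndGate \<and> inputs C g \<noteq> {}"
    then obtain f where f: "f \<in> G" "g = h f" using gC by auto
    then have kf: "nexp_kind f = AndGate" using kd \<open>kind C g = AndGate \<and> inputs C g \<noteq> {}\<close> by simp
    have "nexp_args f \<noteq> {}"
      using f inp \<open>kind C g = AndGate \<and> inputs C g \<noteq> {}\<close> by auto
    then obtain f1 f2 where f12: "f = And f1 f2" using kf by (cases f) (auto split: if_splits)
    then have fG: "f1 \<in> G" "f2 \<in> G" using args[OF f(1)] by auto
    have "And f1 f2 \<in> subexps e" using f f12 by (auto simp: G_def)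
    then obtain t1 t2 where t: "f1 \<noteq> f2" "VNode2 t1 t2 \<in> vtree_nodes T"
      "nexp_vars f1 \<subseteq> set (vtree_leaves t1)" "nexp_vars f2 \<subseteq> set (vtree_leaves t2)"
      using str unfolding nexp_structured_def by blast
    show "\<exists>gs. distinct gs \<and> set gs = inputs C g \<and>
         (\<exists>n \<in> vtree_nodes T. length (vtree_children n) = length gs \<and>
           (\<forall>i < length gs. Vars C (gs ! i) \<subseteq> set (vtree_leaves (vtree_children n ! i))))"
      using t fG hinj[OF fG] inp[OF f(1)] f f12 VarsC[OF fG(1)] VarsC[OF fG(2)]
      by (intro exI[of _ "[h f1, h f2]"] conjI bexI[OF _ t(2)])
         (auto simp: less_Suc_eq numeral_2_eq_2)
  qed
  moreover have "\<forall>\<nu>. circuit_value C \<nu> = nexp_val \<nu> e"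
    using val[OF eG] by (simp add: circuit_value_def C_def)
  moreover have "circuit_size C \<le> 3 * (card (subexps e) + card V)"
  proof -
    have "card (gates C) \<le> card G" using finG by (simp add: gC card_image_le)
    moreover have "card (wires C) \<le> (\<Sum>f\<in>G. card ((\<lambda>g. (h g, h f)) ` nexp_args f))"
      using finG by (simp add: C_def card_UN_le)
    moreover have "\<dots> \<le> (\<Sum>f\<in>G. 2)"
      by (intro sum_mono order.trans[OF card_image_le card_nexp_args_le]) simp
    moreover have "card G \<le> card (subexps e) + card V"
      unfolding G_def using card_image_le[OF fin, of Var] card_Un_le[of "subexps e" "Var ` V"] by linarith
    ultimately show ?thesis by (simp add: circuit_size_def)
  qed
  ultimately show ?thesis
    using vg unfolding d_sdnnf_def sdnnf_def by blast
qed

section \<open>Dynamic programming along an elimination forest\<close>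

text \<open>A nonempty forest in binary form: \<open>Up v t\<close> hangs the forest
  \<open>t\<close> below the root \<open>v\<close>, and \<open>Join\<close> puts two forests side by
  side without adding a variable. In this form a forest can be read as a v-tree directly.\<close>

datatype 'v elim_forest =
    Leaf 'v
  | Up 'v "'v elim_forest"
  | Join "'v elim_forest" "'v elim_forest"

primrec forest_vtree :: "'v elim_forest \<Rightarrow> 'v vtree" where
  "forest_vtree (Leaf v) = VLeaf v"
| "forest_vtree (Up v t) = VNode2 (VLeaf v) (forest_vtree t)"
| "forest_vtree (Join t u) = VNode2 (forest_vtree t) (forest_vtree u)"

primrec forest_nodes :: "'v elim_forest \<Rightarrow> nat" where
  "forest_nodes (Leaf v) = 1"
| "forest_nodes (Up v t) = 1 + forest_nodes t"
| "forest_nodes (Join t u) = 1 + forest_nodes t + forest_nodes u"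

lemma set_forest_vtree [simp]: "set (vtree_leaves (forest_vtree t)) = set_elim_forest t"
  by (induction t) auto

lemma forest_nodes_le: "forest_nodes t + 1 \<le> 2 * length (vtree_leaves (forest_vtree t))"
  by (induction t) auto

text \<open>
  Every bag \<open>B v\<close> consists of \<open>v\<close> and of ancestors of \<open>v\<close>; \<open>X\<close> is what the forest sees of the
  variables above its roots.
\<close>

primrec forest_bags :: "('v \<Rightarrow> 'v set) \<Rightarrow> 'v elim_forest \<Rightarrow> 'v set \<Rightarrow> bool" where
  "forest_bags B (Leaf v) X \<longleftrightarrow> v \<in> B v \<and> B v \<subseteq> insert v X"
| "forest_bags B (Up v t) X \<longleftrightarrow> v \<in> B v \<and> B v \<subseteq> insert v X \<and> forest_bags B t (B v)"
| "forest_bags B (Join t u) X \<longleftrightarrow> forest_bags B t X \<and> forest_bags B u X"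

lemma finite_card_subset_le: "A \<subseteq> S \<Longrightarrow> finite S \<Longrightarrow> card S \<le> n \<Longrightarrow> finite A \<and> card A \<le> n"
  by (meson card_mono finite_subset le_trans)

lemma card_image_states_le:
  fixes f :: "'v set \<times> 'b::finite \<Rightarrow> 'c"
  assumes "finite X" "card X \<le> w"
  shows "card (f ` (Pow X \<times> UNIV)) \<le> card (UNIV :: 'b set) * 2 ^ w"
proof -
  have "card (f ` (Pow X \<times> UNIV)) \<le> card (Pow X \<times> (UNIV :: 'b set))"
    using assms(1) by (intro card_image_le finite_cartesian_product) auto
  also have "\<dots> \<le> card (UNIV :: 'b set) * 2 ^ w"
    using assms by (simp add: card_cartesian_product card_Pow)
  finally show ?thesis .
qed

context
  fixes \<phi> :: "'v clauses" and B :: "'v \<Rightarrow> 'v set" and s :: bool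
begin

text \<open>Used with \<alpha> inside \<open>B v\<close>: then it looks for a clause owned by
  \<open>v\<close>, meaning that it contains \<open>v\<close> and lies in \<open>B v\<close>, all of
  whose variables have the value \<open>s\<close>.\<close>

definition hit :: "'v \<Rightarrow> 'v set \<Rightarrow> bool" where
  "hit v \<alpha> \<longleftrightarrow> (\<exists>K \<in> \<phi>. v \<in> K \<and> K \<subseteq> \<alpha>)"

text \<open>Forgetting all variables outside \<open>B v\<close> keeps the number of states below
  \<open>2 ^ w\<close>.\<close>

definition next_state :: "'v \<Rightarrow> bool \<Rightarrow> 'v set \<Rightarrow> 'v set" where
  "next_state v b \<alpha> = (if b then insert v \<alpha> else \<alpha>) \<inter> B v"

text \<open>The flag \<open>b\<close> tells whether \<open>v\<close> has the value \<open>s\<close>;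
  it is the value of \<open>v\<close> only if \<open>s\<close> is true.\<close>

definition lit :: "'v \<Rightarrow> bool \<Rightarrow> 'v nexp" where
  "lit v b = (if b = s then Var v else Neg v)"

text \<open>
  The state \<open>\<alpha>\<close> is the set of variables in view that have the value \<open>s\<close>; \<open>q\<close> is the claimed
  answer to the question whether some clause owned by the forest has all its variables
  equal to \<open>s\<close>.
\<close>

primrec forest_exp :: "'v elim_forest \<Rightarrow> 'v set \<Rightarrow> bool \<Rightarrow> 'v nexp" where
  "forest_exp (Leaf v) \<alpha> q =
     (let br = (\<lambda>b. if hit v (next_state v b \<alpha>) = q then lit v b else Cst v False)
      in Or (br True) (br False))"
| "forest_exp (Up v t) \<alpha> q =
     (let br = (\<lambda>b. And (lit v b)
        (if hit v (next_state v b \<alpha>) then Cst v q else forest_exp t (next_state v b \<alpha>) q))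
      in Or (br True) (br False))"
| "forest_exp (Join t u) \<alpha> q =
     (let e = And (forest_exp t \<alpha> False) (forest_exp u \<alpha> q)
      in if q then Or (forest_exp t \<alpha> True) e else e)"

lemma nexp_val_lit [simp]: "nexp_val \<nu> (lit v b) \<longleftrightarrow> (\<nu> v = s) = b"
  by (auto simp: lit_def)

lemma nexp_vars_lit [simp]: "nexp_vars (lit v b) = {v}"
  by (auto simp: lit_def)

lemma set_nexp_lit [simp]: "set_nexp (lit v b) = {v}"
  by (auto simp: lit_def)

lemma subexps_lit: "subexps (lit v b) \<subseteq> {Var v, Neg v}"
  by (auto simp: lit_def)

lemma Or_not_in_subexps_lit [simp]: "Or e f \<notin> subexps (lit v b)"
  and And_not_in_subexps_lit [simp]: "And e f \<notin> subexps (lit v b)"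
  by (auto simp: lit_def)

text \<open>In negation normal form an answer cannot be negated, so its complement has to be a gate
  of its own. At a \<open>Join\<close> this makes the two disjuncts exclusive: one contains
  \<open>forest_exp t \<alpha> True\<close>, the other
  \<open>forest_exp t \<alpha> False\<close>.\<close>

lemma forest_exp_val_False: "nexp_val \<nu> (forest_exp t \<alpha> False) \<longleftrightarrow> \<not> nexp_val \<nu> (forest_exp t \<alpha> True)"
  by (induction t arbitrary: \<alpha>) (auto simp: Let_def)

text \<open>As \<open>B v\<close> lies in \<open>insert v X\<close>, the old state and the bit of
  \<open>v\<close> determine the new state.\<close>

lemma next_state_agree:
  assumes "v \<in> B v" "B v \<subseteq> insert v X"
  shows "next_state v (v \<in> A) (A \<inter> X) = A \<inter> B v"
  using assms by (auto simp: next_state_def)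

lemma forest_exp_val:
  assumes "forest_bags B t X"
  shows "nexp_val \<nu> (forest_exp t ({x. \<nu> x = s} \<inter> X) q) \<longleftrightarrow>
    q = (\<exists>v \<in> set_elim_forest t. hit v ({x. \<nu> x = s} \<inter> B v))"
  using assms
proof (induction t arbitrary: X q)
  case (Leaf v)
  then have "next_state v (\<nu> v = s) ({x. \<nu> x = s} \<inter> X) = {x. \<nu> x = s} \<inter> B v"
    using next_state_agree[of v X "{x. \<nu> x = s}"] by simp
  then show ?case by (cases "\<nu> v = s") (auto simp: Let_def)
next
  case (Up v t)
  then have *: "next_state v (\<nu> v = s) ({x. \<nu> x = s} \<inter> X) = {x. \<nu> x = s} \<inter> B v"
    using next_state_agree[of v X "{x. \<nu> x = s}"] by simp
  have "forest_bags B t (B v)" using Up by simp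
  note IH = Up.IH[OF this]
  show ?case using * IH by (cases "\<nu> v = s") (auto simp: Let_def)
next
  case (Join t u)
  then show ?case by (auto simp: Let_def)
qed

text \<open>\<open>set_nexp\<close> also counts the tags of constants. Unlike
  \<open>nexp_vars\<close> it is never empty here, so expressions of disjoint forests are told apart
  by it.\<close>

lemma set_forest_exp:
  "set_nexp (forest_exp t \<alpha> q) \<subseteq> set_elim_forest t" "set_nexp (forest_exp t \<alpha> q) \<noteq> {}"
proof -
  show "set_nexp (forest_exp t \<alpha> q) \<subseteq> set_elim_forest t"
  proof (induction t arbitrary: \<alpha> q)
    case (Up v t)
    then show ?case by (simp add: Let_def) blast
  next
    case (Join t u)
    then show ?case by (simp add: Let_def) blast
  qed (simp add: Let_def)
  show "set_nexp (forest_exp t \<alpha> q) \<noteq> {}"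
    by (induction t arbitrary: \<alpha> q) (auto simp: Let_def)
qed

lemma nexp_vars_le_set: "nexp_vars e \<subseteq> set_nexp e"
  by (induction e) auto

lemma nexp_vars_forest_exp: "nexp_vars (forest_exp t \<alpha> q) \<subseteq> set_elim_forest t"
  using nexp_vars_le_set set_forest_exp(1) by (rule order.trans)

text \<open>The branches of a decision on \<open>v\<close> carry opposite literals or are constantly
  false, and those of a \<open>Join\<close> claim opposite answers for the left part. Two constantly
  false branches of a leaf are the same expression, hence a single input.\<close>

lemma forest_exp_deterministic: "nexp_deterministic (forest_exp t \<alpha> q)"
proof -
  have "\<not> (nexp_val \<nu> f \<and> nexp_val \<nu> g)"
    if "Or f g \<in> subexps (forest_exp t \<alpha> q)" "f \<noteq> g" for f g \<nu>
    using that
  proof (induction t arbitrary: \<alpha> q)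
    case (Leaf v)
    then show ?case by (auto simp: Let_def split: if_splits)
  next
    case (Up v t)
    then show ?case by (auto simp: Let_def split: if_splits)
  next
    case (Join t u)
    then show ?case by (auto simp: Let_def forest_exp_val_False split: if_splits)
  qed
  then show ?thesis by (auto simp: nexp_deterministic_def)
qed

lemma forest_exp_structured:
  assumes "distinct (vtree_leaves (forest_vtree t))" "vtree_nodes (forest_vtree t) \<subseteq> N"
  shows "nexp_structured N (forest_exp t \<alpha> q)"
proof -
  have "f \<noteq> g \<and> (\<exists>t1 t2. VNode2 t1 t2 \<in> N \<and> nexp_vars f \<subseteq> set (vtree_leaves t1) \<and>
         nexp_vars g \<subseteq> set (vtree_leaves t2))"
    if "And f g \<in> subexps (forest_exp t \<alpha> q)" for f g
    using that assms
  proof (induction t arbitrary: \<alpha> q)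
    case (Leaf v)
    then show ?case by (auto simp: Let_def split: if_splits)
  next
    case (Up v t)
    have *: "VNode2 (VLeaf v) (forest_vtree t) \<in> N" using Up.prems by simp
    consider (sub) \<beta> where "And f g \<in> subexps (forest_exp t \<beta> q)"
      | (top) b \<beta> where "f = lit v b" "g = Cst v q \<or> g = forest_exp t \<beta> q"
      using Up.prems(1) by (auto simp: Let_def split: if_splits)
    then show ?case
    proof cases
      case sub
      show ?thesis by (rule Up.IH[OF sub]) (use Up.prems in auto)
    next
      case top
      have "v \<notin> set_elim_forest t" using Up.prems by auto
      \<comment> \<open>A constant \<open>Cst v q\<close> has the same tag as the literal; there the
        constructors differ.\<close>
      then have "set_nexp f \<noteq> set_nexp g \<or> g = Cst v q"
        using top set_forest_exp(1)[of t \<beta> q] by auto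
      then have "f \<noteq> g" using top by (auto simp: lit_def)
      moreover have "nexp_vars g \<subseteq> set_elim_forest t"
        using top(2) nexp_vars_forest_exp[of t \<beta> q] by (elim disjE) simp_all
      ultimately show ?thesis
        using top * by (intro conjI exI[of _ "VLeaf v"] exI[of _ "forest_vtree t"]) simp_all
    qed
  next
    case (Join t u)
    have *: "VNode2 (forest_vtree t) (forest_vtree u) \<in> N" using Join.prems by simp
    have disj: "set_elim_forest t \<inter> set_elim_forest u = {}" using Join.prems by auto
    consider (left) p where "And f g \<in> subexps (forest_exp t \<alpha> p)"
      | (right) p where "And f g \<in> subexps (forest_exp u \<alpha> p)"
      | (top) "f = forest_exp t \<alpha> False" "g = forest_exp u \<alpha> q"
      using Join.prems(1) by (auto simp: Let_def split: if_splits)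
    then show ?case
    proof cases
      case left
      show ?thesis by (rule Join.IH(1)[OF left]) (use Join.prems in auto)
    next
      case right
      show ?thesis by (rule Join.IH(2)[OF right]) (use Join.prems in auto)
    next
      case top
      have sub: "set_nexp f \<subseteq> set_elim_forest t" "set_nexp g \<subseteq> set_elim_forest u" "set_nexp f \<noteq> {}"
        unfolding top by (rule set_forest_exp)+
      have "f \<noteq> g"
      proof
        assume "f = g"
        then show False using sub disj by blast
      qed
      moreover have "nexp_vars f \<subseteq> set_elim_forest t" "nexp_vars g \<subseteq> set_elim_forest u"
        using sub nexp_vars_le_set by (metis order.trans)+
      ultimately show ?thesis
        using * by (intro conjI exI[of _ "forest_vtree t"] exI[of _ "forest_vtree u"]) simp_all
    qed
  qed
  then show ?thesis by (auto simp: nexp_structured_def)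
qed

text \<open>Taken over all states and both answers, so that the set for a subforest contains
  whatever the levels above refer to. A subexpression shared by many states is counted once.\<close>

definition forest_subexps :: "'v elim_forest \<Rightarrow> 'v set \<Rightarrow> 'v nexp set" where
  "forest_subexps t X = (\<Union>\<alpha> \<in> Pow X. \<Union>q. subexps (forest_exp t \<alpha> q))"

lemma forest_subexps_subsetI:
  "(\<And>\<alpha> q. \<alpha> \<subseteq> X \<Longrightarrow> subexps (forest_exp t \<alpha> q) \<subseteq> S) \<Longrightarrow> forest_subexps t X \<subseteq> S"
  by (auto simp: forest_subexps_def)

text \<open>The factor 10 is the cost of an \<open>Up\<close> node. Each state needs two decisions,
  one for each answer, and four branches; the four literals and constants are charged to the states
  by \<open>1 \<le> 2 ^ w\<close>. The other two kinds of node cost less.\<close>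

lemma card_forest_subexps:
  assumes "forest_bags B t X" "finite X" "card X \<le> w" "\<And>v. v \<in> set_elim_forest t \<Longrightarrow> card (B v) \<le> w"
  shows "finite (forest_subexps t X) \<and> card (forest_subexps t X) \<le> 10 * 2 ^ w * forest_nodes t"
  using assms
proof (induction t arbitrary: X)
  case (Leaf v)
  let ?I = "Pow X \<times> (UNIV :: bool set)"
  let ?S = "(\<lambda>(\<alpha>, q). forest_exp (Leaf v) \<alpha> q) ` ?I \<union> {Var v, Neg v, Cst v False}"
  have sub: "subexps (forest_exp (Leaf v) \<alpha> q) \<subseteq> ?S" if "\<alpha> \<subseteq> X" for \<alpha> q
  proof -
    define br where "br = (\<lambda>b. if hit v (next_state v b \<alpha>) = q then lit v b else Cst v False)"
    have "forest_exp (Leaf v) \<alpha> q = Or (br True) (br False)" by (simp add: br_def)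
    moreover have "forest_exp (Leaf v) \<alpha> q \<in> (\<lambda>(\<alpha>, q). forest_exp (Leaf v) \<alpha> q) ` ?I"
      by (rule image_eqI[of _ _ "(\<alpha>, q)"]) (use that in auto)
    moreover have "subexps (br b) \<subseteq> {Var v, Neg v, Cst v False}" for b
      using subexps_lit[of v b] by (auto simp: br_def)
    ultimately show ?thesis by auto
  qed
  have "forest_subexps (Leaf v) X \<subseteq> ?S"
    by (rule forest_subexps_subsetI) (rule sub)
  moreover have fin: "finite ?S" using Leaf by simp
  moreover have "card ?S \<le> 10 * 2 ^ w"
  proof -
    have "card ((\<lambda>(\<alpha>, q). forest_exp (Leaf v) \<alpha> q) ` ?I) \<le> card (UNIV :: bool set) * 2 ^ w"
      by (rule card_image_states_le[OF Leaf(2,3)])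
    then have "card ((\<lambda>(\<alpha>, q). forest_exp (Leaf v) \<alpha> q) ` ?I) \<le> 2 * 2 ^ w" by simp
    moreover have "card {Var v, Neg v, Cst v False} \<le> 3" by (simp add: card_insert_if)
    moreover have "(1::nat) \<le> 2 ^ w" by simp
    moreover have "card ?S \<le> card ((\<lambda>(\<alpha>, q). forest_exp (Leaf v) \<alpha> q) ` ?I) +
      card {Var v, Neg v, Cst v False}" by (rule card_Un_le)
    ultimately show ?thesis by linarith
  qed
  ultimately show ?case unfolding forest_nodes.simps mult_1_right by (rule finite_card_subset_le)
next
  case (Up v t)
  let ?I = "Pow X \<times> (UNIV :: bool set)"
  let ?J = "Pow X \<times> (UNIV :: (bool \<times> bool) set)"
  let ?S1 = "(\<lambda>(\<alpha>, q). forest_exp (Up v t) \<alpha> q) ` ?I"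
  let ?S2 = "(\<lambda>(\<alpha>, q, b). And (lit v b)
    (if hit v (next_state v b \<alpha>) then Cst v q else forest_exp t (next_state v b \<alpha>) q)) ` ?J"
  let ?S3 = "{Var v, Neg v, Cst v False, Cst v True}"
  let ?S4 = "forest_subexps t (B v)"
  have B: "forest_bags B t (B v)" "B v \<subseteq> insert v X" using Up.prems by auto
  have "finite (B v)" using B Up.prems finite_subset by blast
  then have IH: "finite ?S4" "card ?S4 \<le> 10 * 2 ^ w * forest_nodes t"
    using Up.IH[OF B(1)] Up.prems by auto
  have sub: "subexps (forest_exp (Up v t) \<alpha> q) \<subseteq> ?S1 \<union> ?S2 \<union> ?S3 \<union> ?S4" if "\<alpha> \<subseteq> X" for \<alpha> q
  proof -
    define br where "br = (\<lambda>b. And (lit v b)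
      (if hit v (next_state v b \<alpha>) then Cst v q else forest_exp t (next_state v b \<alpha>) q))"
    have "forest_exp (Up v t) \<alpha> q = Or (br True) (br False)" by (simp add: br_def)
    moreover have "forest_exp (Up v t) \<alpha> q \<in> ?S1" using that by blast
    moreover have "subexps (br b) \<subseteq> ?S2 \<union> ?S3 \<union> ?S4" for b
    proof -
      have "br b \<in> ?S2"
        unfolding br_def by (rule image_eqI[of _ _ "(\<alpha>, q, b)"]) (use that in auto)
      moreover have "subexps (if hit v (next_state v b \<alpha>) then Cst v q
          else forest_exp t (next_state v b \<alpha>) q) \<subseteq> ?S3 \<union> ?S4"
        by (cases q) (auto simp: forest_subexps_def next_state_def)
      ultimately show ?thesis using subexps_lit[of v b] by (auto simp: br_def)
    qed
    ultimately show ?thesis by auto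
  qed
  have "forest_subexps (Up v t) X \<subseteq> ?S1 \<union> ?S2 \<union> ?S3 \<union> ?S4"
    by (rule forest_subexps_subsetI) (rule sub)
  moreover have fin: "finite (?S1 \<union> ?S2 \<union> ?S3 \<union> ?S4)" using IH Up.prems by simp
  moreover have "card (?S1 \<union> ?S2 \<union> ?S3 \<union> ?S4) \<le> 10 * 2 ^ w + 10 * 2 ^ w * forest_nodes t"
  proof -
    have "card ?S1 \<le> card (UNIV :: bool set) * 2 ^ w"
      "card ?S2 \<le> card (UNIV :: (bool \<times> bool) set) * 2 ^ w"
      by (rule card_image_states_le[OF Up.prems(2,3)])+
    moreover have "card (UNIV :: (bool \<times> bool) set) = 4"
      by (subst UNIV_Times_UNIV[symmetric], subst card_cartesian_product) simp
    ultimately have "card ?S1 \<le> 2 * 2 ^ w" "card ?S2 \<le> 4 * 2 ^ w"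
      by simp_all
    moreover have "card ?S3 \<le> 4" by (simp add: card_insert_if)
    moreover have "(1::nat) \<le> 2 ^ w" by simp
    moreover have "card (?S1 \<union> ?S2 \<union> ?S3 \<union> ?S4) \<le> card ?S1 + card ?S2 + card ?S3 + card ?S4"
      by (intro order.trans[OF card_Un_le] add_mono order.refl)
    ultimately show ?thesis using IH by linarith
  qed
  ultimately show ?case
    unfolding forest_nodes.simps distrib_left mult_1_right by (rule finite_card_subset_le)
next
  case (Join t u)
  let ?I = "Pow X \<times> (UNIV :: bool set)"
  let ?S1 = "(\<lambda>(\<alpha>, q). forest_exp (Join t u) \<alpha> q) ` ?I"
  let ?S2 = "(\<lambda>(\<alpha>, q). And (forest_exp t \<alpha> False) (forest_exp u \<alpha> q)) ` ?I"
  let ?S3 = "forest_subexps t X" and ?S4 = "forest_subexps u X"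
  have IH: "finite ?S3" "card ?S3 \<le> 10 * 2 ^ w * forest_nodes t"
    "finite ?S4" "card ?S4 \<le> 10 * 2 ^ w * forest_nodes u"
    using Join.IH(1)[of X] Join.IH(2)[of X] Join.prems by auto
  have sub: "subexps (forest_exp (Join t u) \<alpha> q) \<subseteq> ?S1 \<union> ?S2 \<union> ?S3 \<union> ?S4" if "\<alpha> \<subseteq> X" for \<alpha> q
  proof -
    have combine: "A \<subseteq> S1 \<union> S2 \<union> S3 \<union> S4"
      if "A \<subseteq> {x, y} \<union> C \<union> D \<union> E" "x \<in> S1" "y \<in> S2" "C \<subseteq> S3" "D \<subseteq> S3" "E \<subseteq> S4"
      for A C D E S1 S2 S3 S4 :: "'v nexp set" and x y
      using that by blast
    show ?thesis
    proof (rule combine)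
      show "subexps (forest_exp (Join t u) \<alpha> q) \<subseteq>
        {forest_exp (Join t u) \<alpha> q, And (forest_exp t \<alpha> False) (forest_exp u \<alpha> q)} \<union>
        subexps (forest_exp t \<alpha> False) \<union> subexps (forest_exp t \<alpha> True) \<union> subexps (forest_exp u \<alpha> q)"
        by (cases q) (auto simp: Let_def)
      show "forest_exp (Join t u) \<alpha> q \<in> ?S1"
        by (rule image_eqI[of _ _ "(\<alpha>, q)"]) (use that in auto)
      show "And (forest_exp t \<alpha> False) (forest_exp u \<alpha> q) \<in> ?S2"
        by (rule image_eqI[of _ _ "(\<alpha>, q)"]) (use that in auto)
    qed (use that in \<open>auto simp: forest_subexps_def\<close>)
  qed
  have "forest_subexps (Join t u) X \<subseteq> ?S1 \<union> ?S2 \<union> ?S3 \<union> ?S4"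
    by (rule forest_subexps_subsetI) (rule sub)
  moreover have fin: "finite (?S1 \<union> ?S2 \<union> ?S3 \<union> ?S4)" using IH Join.prems by simp
  moreover have "card (?S1 \<union> ?S2 \<union> ?S3 \<union> ?S4)
      \<le> 10 * 2 ^ w + 10 * 2 ^ w * forest_nodes t + 10 * 2 ^ w * forest_nodes u"
  proof -
    have "card ?S1 \<le> card (UNIV :: bool set) * 2 ^ w" "card ?S2 \<le> card (UNIV :: bool set) * 2 ^ w"
      by (rule card_image_states_le[OF Join.prems(2,3)])+
    then have "card ?S1 \<le> 2 * 2 ^ w" "card ?S2 \<le> 2 * 2 ^ w" by simp_all
    moreover have "card (?S1 \<union> ?S2 \<union> ?S3 \<union> ?S4) \<le> card ?S1 + card ?S2 + card ?S3 + card ?S4"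
      by (intro order.trans[OF card_Un_le] add_mono order.refl)
    ultimately show ?thesis using IH by linarith
  qed
  ultimately show ?case
    unfolding forest_nodes.simps distrib_left mult_1_right by (rule finite_card_subset_le)
qed

end

lemma exists_d_sdnnf_of_forest:
  fixes \<phi> :: "'v::infinite clauses"
  assumes bags: "forest_bags B t {}" and dist: "distinct (vtree_leaves (forest_vtree t))"
    and set: "set_elim_forest t = \<Union>\<phi>" and w: "\<And>v. v \<in> \<Union>\<phi> \<Longrightarrow> card (B v) \<le> w"
    and own: "\<And>K. K \<in> \<phi> \<Longrightarrow> \<exists>v \<in> K. K \<subseteq> B v"
  shows "\<exists>C. d_sdnnf C \<and> var_gates C = \<Union>\<phi> \<and>
    (\<forall>\<nu>. circuit_value C \<nu> \<longleftrightarrow> q = (\<exists>K \<in> \<phi>. \<forall>x \<in> K. \<nu> x = s)) \<and>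
    circuit_size C \<le> 63 * 2 ^ w * card (\<Union>\<phi>)"
proof -
  define e where "e = forest_exp \<phi> B s t {} q"
  have len: "length (vtree_leaves (forest_vtree t)) = card (\<Union>\<phi>)"
    using dist set distinct_card by fastforce
  have fin: "finite (\<Union>\<phi>)" using set set_forest_vtree[of t] by (metis finite_set)
  obtain C where C: "d_sdnnf C" "var_gates C = \<Union>\<phi>" "\<And>\<nu>. circuit_value C \<nu> = nexp_val \<nu> e"
    "circuit_size C \<le> 3 * (card (subexps e) + card (\<Union>\<phi>))"
  proof -
    have "nexp_vars e \<subseteq> \<Union>\<phi>" unfolding e_def set[symmetric] by (rule nexp_vars_forest_exp)
    moreover have "nexp_deterministic e" unfolding e_def by (rule forest_exp_deterministic)
    moreover have "nexp_structured (vtree_nodes (forest_vtree t)) e"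
      unfolding e_def by (rule forest_exp_structured[OF dist order.refl])
    moreover have "vtree_over (forest_vtree t) (\<Union>\<phi>)" using dist set by (simp add: vtree_over_def)
    ultimately show thesis using exists_d_sdnnf_of_nexp fin that by blast
  qed
  have "nexp_val \<nu> e \<longleftrightarrow> q = (\<exists>K \<in> \<phi>. \<forall>x \<in> K. \<nu> x = s)" for \<nu>
  proof -
    have "(\<exists>v \<in> \<Union>\<phi>. hit \<phi> v ({x. \<nu> x = s} \<inter> B v)) \<longleftrightarrow> (\<exists>K \<in> \<phi>. \<forall>x \<in> K. \<nu> x = s)" (is "?l \<longleftrightarrow> ?r")
    proof
      assume ?r
      then obtain K where K: "K \<in> \<phi>" "\<forall>x \<in> K. \<nu> x = s" by blast
      then obtain v where "v \<in> K" "K \<subseteq> B v" using own by blast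
      then have "v \<in> \<Union>\<phi>" "hit \<phi> v ({x. \<nu> x = s} \<inter> B v)" using K by (auto simp: hit_def)
      then show ?l by blast
    qed (auto simp: hit_def)
    moreover have "nexp_val \<nu> e \<longleftrightarrow> q = (\<exists>v \<in> \<Union>\<phi>. hit \<phi> v ({x. \<nu> x = s} \<inter> B v))"
      using forest_exp_val[where B = B and \<phi> = \<phi> and s = s, OF bags, of \<nu> q] by (simp only: e_def set Int_empty_right)
    ultimately show ?thesis by simp
  qed
  moreover have "circuit_size C \<le> 63 * 2 ^ w * card (\<Union>\<phi>)"
  proof -
    have sub: "subexps e \<subseteq> forest_subexps \<phi> B s t {}" by (auto simp: e_def forest_subexps_def)
    have "finite (forest_subexps \<phi> B s t {}) \<and>
      card (forest_subexps \<phi> B s t {}) \<le> 10 * 2 ^ w * forest_nodes t"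
      using w by (intro card_forest_subexps[OF bags]) (simp_all add: set)
    then have "card (subexps e) \<le> 10 * 2 ^ w * forest_nodes t"
      using card_mono[OF _ sub] by linarith
    also have "\<dots> \<le> 10 * 2 ^ w * (2 * card (\<Union>\<phi>))"
      using forest_nodes_le[of t] len by (intro mult_left_mono) auto
    finally have "circuit_size C \<le> 3 * (20 * 2 ^ w * card (\<Union>\<phi>) + card (\<Union>\<phi>))" using C(4) by simp
    \<comment> \<open>The variable gates are absorbed by one more multiple of \<open>2 ^ w\<close>,
      whence 63 = 3 * (20 + 1).\<close>
    also have "\<dots> \<le> 3 * (20 * 2 ^ w * card (\<Union>\<phi>) + 2 ^ w * card (\<Union>\<phi>))"
      by simp
    finally show ?thesis by (simp add: algebra_simps)
  qed
  ultimately show ?thesis using C(1-3) by (intro exI[of _ C]) simp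
qed

section \<open>Rooted tree decompositions and elimination orders\<close>

text \<open>\<open>d\<close> is a potential that drops towards the root. For a given tree it is the
  length of the path to the root; for a v-tree it will be the size of the complement of a
  node.\<close>

definition rooted_tree :: "'n set \<Rightarrow> 'n \<Rightarrow> ('n \<Rightarrow> 'n) \<Rightarrow> ('n \<Rightarrow> nat) \<Rightarrow> bool" where
  "rooted_tree N r p d \<longleftrightarrow> finite N \<and> r \<in> N \<and> (\<forall>t \<in> N - {r}. p t \<in> N \<and> d (p t) < d t)"

text \<open>For a set of nodes of a rooted tree this is connectedness: every node except the top can
  climb to its parent without leaving \<open>A\<close>.\<close>

definition has_top :: "'n \<Rightarrow> ('n \<Rightarrow> 'n) \<Rightarrow> 'n set \<Rightarrow> bool" where
  "has_top r p A \<longleftrightarrow> (\<exists>t \<in> A. \<forall>i \<in> A - {t}. i \<noteq> r \<and> p i \<in> A)"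

lemma exists_max_on:
  fixes f :: "'a \<Rightarrow> 'b::linorder"
  assumes "finite K" "K \<noteq> {}"
  shows "\<exists>v \<in> K. \<forall>u \<in> K. f u \<le> f v"
proof -
  have "Max (f ` K) \<in> f ` K" using assms by (intro Max_in) auto
  then obtain v where "v \<in> K" "f v = Max (f ` K)" by auto
  then show ?thesis using assms by (intro bexI[of _ v]) auto
qed

text \<open>The parent of \<open>t\<close> is the second vertex on the unique path from
  \<open>t\<close> to \<open>r\<close>. For an arc from \<open>i\<close> to \<open>j\<close>, either
  \<open>i\<close> is not on the path of \<open>j\<close>, and then the arc extends that path to the
  one of \<open>i\<close>; or the path of \<open>j\<close> starts with a path to \<open>i\<close>,
  which by uniqueness is the reversed arc alone.\<close>

lemma exists_rooting:
  assumes tree: "undirected_tree T" and r: "r \<in> pverts T"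
  shows "\<exists>p d. rooted_tree (pverts T) r p d \<and>
    (\<forall>(i, j) \<in> parcs T. i \<noteq> r \<and> p i = j \<or> j \<noteq> r \<and> p j = i)"
proof -
  interpret pair_graph T using tree by (simp add: undirected_tree_def)
  have uniq: "\<exists>!q. apath s q t" if "s \<in> pverts T" "t \<in> pverts T" for s t
    using tree that by (simp add: undirected_tree_def)
  define P where "P t = (THE q. apath t q r)" for t
  have P: "apath t (P t) r" if "t \<in> pverts T" for t
    unfolding P_def by (rule theI') (rule uniq[OF that r])
  have P_eq: "P t = q" if "apath t q r" for t q
  proof -
    have "t \<in> pverts T" using that by (auto simp: apath_def)
    then show ?thesis using uniq[of t r] r P that by blast
  qed
  \<comment> \<open>The path of \<open>r\<close> is empty, so \<open>p r\<close> is an unspecified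
    value; parents are only ever asked of nodes other than \<open>r\<close>.\<close>
  define p where "p t = snd (hd (P t))" for t
  have parent: "p t \<in> pverts T \<and> length (P (p t)) < length (P t)" if t: "t \<in> pverts T - {r}" for t
  proof -
    have "P t \<noteq> []" using P[of t] t by (auto simp: apath_Nil_iff)
    then obtain e q where e: "P t = e # q" by (cases "P t") auto
    then have "apath (snd e) q r" "e \<in> parcs T" using P[of t] t by (auto simp: apath_Cons_iff)
    then show ?thesis using e P_eq[of "snd e" q] by (auto simp: p_def dest: arc_snd_in_verts)
  qed
  have arcs: "i \<noteq> r \<and> p i = j \<or> j \<noteq> r \<and> p j = i" if ij: "(i, j) \<in> parcs T" for i j
  proof -
    have V: "i \<in> pverts T" "j \<in> pverts T" "i \<noteq> j" using ij in_arcsD1 in_arcsD2 no_loops' by auto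
    show ?thesis
    proof (cases "i \<in> set (pawalk_verts j (P j))")
      case False
      then have a: "apath i ((i, j) # P j) r" using P[OF V(2)] ij by (simp add: apath_Cons_iff)
      then have "p i = j" using P_eq by (simp add: p_def)
      moreover have "i \<noteq> r" using apath_nonempty_ends[OF a] by simp
      ultimately show ?thesis by simp
    next
      case True
      then obtain q1 q2 where q: "P j = q1 @ q2" "awalk j q1 i" "awalk i q2 r"
        using awalk_decomp[of j "P j" r i] P[OF V(2)] by (auto simp: apath_def)
      then have "apath j q1 i"
        using P[OF V(2)] by (auto simp: apath_append_iff)
      moreover have "apath j [(j, i)] i"
        using ij V arcs_symmetric by (auto simp: apath_Cons_iff apath_Nil_iff)
      ultimately have "q1 = [(j, i)]" using uniq V by blast
      then have "p j = i" "P j \<noteq> []" using q by (auto simp: p_def)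
      moreover have "j \<noteq> r" using apath_nonempty_ends[OF P[OF V(2)]] \<open>P j \<noteq> []\<close> by simp
      ultimately show ?thesis by simp
    qed
  qed
  have "rooted_tree (pverts T) r p (\<lambda>t. length (P t))"
    using parent r pair_finite_verts by (simp add: rooted_tree_def)
  then show ?thesis using arcs by (intro exI[of _ p] exI[of _ "\<lambda>t. length (P t)"]) auto
qed

text \<open>The top is a node \<open>t\<close> of least depth in \<open>A\<close>. If the parent of
  another node \<open>i\<close> were outside \<open>A\<close>, no walk inside \<open>A\<close> could
  climb above \<open>i\<close>; then \<open>t\<close> would be a descendant of \<open>i\<close> and
  hence deeper.\<close>

lemma has_top_of_connected:
  assumes rt: "rooted_tree (pverts T) r p d"
    and arcs: "\<forall>(i, j) \<in> parcs T. i \<noteq> r \<and> p i = j \<or> j \<noteq> r \<and> p j = i"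
    and conn: "Digraph_Component.connected (with_proj T \<restriction> A)" and A: "A \<subseteq> pverts T"
  shows "has_top r p A"
proof -
  define R where "R = {(t, p t) | t. t \<in> pverts T - {r}}"
  define S where "S = (\<Union>e \<in> {e \<in> parcs T. fst e \<in> A \<and> snd e \<in> A}. {(fst e, snd e), (snd e, fst e)})"
  have reach: "(s, t) \<in> rtrancl_on A S" if "s \<in> A" "t \<in> A" for s t
    using conn that
    by (auto simp: Digraph_Component.connected_def strongly_connected_def reachable_def
        parcs_mk_symmetric S_def)
  have "A \<noteq> {}"
    using conn by (auto simp: Digraph_Component.connected_def strongly_connected_def)
  then obtain t where t: "t \<in> A" "\<And>s. s \<in> A \<Longrightarrow> d t \<le> d s"
    using arg_min_nat_lemma[of "\<lambda>t. t \<in> A" _ d] by (metis all_not_in_conv)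
  have dec: "y = x \<or> d y < d x" if "(x, y) \<in> R\<^sup>*" for x y
    using that
  proof (induction rule: rtrancl_induct)
    case (step y z)
    then have "d z < d y" using rt by (auto simp: R_def rooted_tree_def)
    then show ?case using step.IH by auto
  qed simp
  have "i \<noteq> r \<and> p i \<in> A" if i: "i \<in> A - {t}" for i
  proof (rule ccontr)
    assume top: "\<not> (i \<noteq> r \<and> p i \<in> A)"
    have "(t, i) \<in> R\<^sup>*" if "(i, t) \<in> rtrancl_on A S" for t
      using that
    proof (induction rule: rtrancl_on_induct)
      case (step y z)
      from \<open>(y, z) \<in> S\<close> consider (down) "z \<noteq> r" "p z = y" | (up) "y \<noteq> r" "p y = z"
        using arcs by (auto simp: S_def)
      then show ?case
      proof cases
        case down
        then have "(z, y) \<in> R" using \<open>z \<in> A\<close> A by (auto simp: R_def)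
        then show ?thesis using step.IH by (rule converse_rtrancl_into_rtrancl)
      next
        case up
        then have "y \<noteq> i" using top \<open>z \<in> A\<close> by auto
        with step.IH obtain z' where "(y, z') \<in> R" "(z', i) \<in> R\<^sup>*" by (meson converse_rtranclE)
        then show ?thesis using up by (auto simp: R_def)
      qed
    qed simp
    then have "(t, i) \<in> R\<^sup>*" using reach i t by auto
    then have "i = t \<or> d i < d t" by (rule dec)
    then show False using t(2)[of i] i by auto
  qed
  then show ?thesis using t by (auto simp: has_top_def)
qed

text \<open>
  Each variable is placed at the top node of its bags, and the variables are ordered by the depth
  of these nodes. Equivalently, \<open>B\<close> describes a perfect elimination order of a chordal
  graph containing all the clauses.
\<close>

lemma exists_elimination_order:
  fixes V :: "'v set"
  assumes td: "tree_decomposition V E T bag" and fin: "finite V"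
    and w: "\<And>t. t \<in> pverts T \<Longrightarrow> card (bag t) \<le> w"
  obtains rank :: "'v \<Rightarrow> nat" and B :: "'v \<Rightarrow> 'v set" where
    "inj_on rank V"
    "\<And>v. v \<in> V \<Longrightarrow> v \<in> B v \<and> B v \<subseteq> V \<and> card (B v) \<le> w"
    "\<And>u v. v \<in> V \<Longrightarrow> u \<in> B v \<Longrightarrow> rank u \<le> rank v"
    "\<And>u v w. v \<in> V \<Longrightarrow> u \<in> B v \<Longrightarrow> w \<in> B v \<Longrightarrow> rank u \<le> rank w \<Longrightarrow> u \<in> B w"
    "\<And>K. K \<in> E \<Longrightarrow> K \<noteq> {} \<Longrightarrow> \<exists>v \<in> K. K \<subseteq> B v"
proof -
  have tree: "undirected_tree T" using td by (simp add: tree_decomposition_def)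
  then obtain r where r: "r \<in> pverts T" by (auto simp: undirected_tree_def)
  obtain p d where rt: "rooted_tree (pverts T) r p d"
    and arcs: "\<forall>(i, j) \<in> parcs T. i \<noteq> r \<and> p i = j \<or> j \<noteq> r \<and> p j = i"
    using exists_rooting[OF tree r] by blast
  define A where "A v = {t \<in> pverts T. v \<in> bag t}" for v
  have "has_top r p (A v)" if "v \<in> V" for v
    unfolding A_def using td that
    by (intro has_top_of_connected[OF rt arcs]) (auto simp: tree_decomposition_def)
  then obtain \<tau> where \<tau>: "\<And>v. v \<in> V \<Longrightarrow> \<tau> v \<in> A v"
    "\<And>v i. v \<in> V \<Longrightarrow> i \<in> A v \<Longrightarrow> i \<noteq> \<tau> v \<Longrightarrow> i \<noteq> r \<and> p i \<in> A v"
    unfolding has_top_def by (metis DiffI singletonD)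
  have bagV: "bag t \<subseteq> V" if "t \<in> pverts T" for t
    using td that by (auto simp: tree_decomposition_def)
  have dec: "d (p i) < d i" if "v \<in> V" "i \<in> A v" "i \<noteq> \<tau> v" for v i
    using \<tau>(2)[OF that] rt that by (auto simp: rooted_tree_def A_def)
  have top_le: "d (\<tau> v) \<le> d i" if "v \<in> V" "i \<in> A v" for v i
    using that
  proof (induction "d i" arbitrary: i rule: less_induct)
    case less
    show ?case
    proof (cases "i = \<tau> v")
      case False
      then show ?thesis using less.hyps[of "p i"] dec[OF less.prems] \<tau>(2)[OF less.prems] less.prems by force
    qed simp
  qed
  \<comment> \<open>Climb from the common node \<open>t\<close> towards the top of \<open>v\<close>.
    The top of \<open>u\<close> is not deeper, so every node passed on the way still contains
    \<open>u\<close>.\<close>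
  have key: "u \<in> bag (\<tau> v)" if "u \<in> V" "v \<in> V" "t \<in> A u" "t \<in> A v" "d (\<tau> u) \<le> d (\<tau> v)" for u v t
    using that
  proof (induction "d t" arbitrary: t rule: less_induct)
    case less
    show ?case
    proof (cases "t = \<tau> v")
      case True
      then show ?thesis using less.prems by (simp add: A_def)
    next
      case False
      have "d (p t) < d t" "p t \<in> A v" using dec \<tau>(2) less.prems False by auto
      moreover have "t \<noteq> \<tau> u"
        using top_le[OF \<open>v \<in> V\<close> \<open>p t \<in> A v\<close>] \<open>d (p t) < d t\<close> less.prems by auto
      then have "p t \<in> A u" using \<tau>(2) less.prems by blast
      ultimately show ?thesis using less.hyps less.prems by blast
    qed
  qed
  define n where "n = card V"
  obtain e where e: "inj_on e V" "\<And>v. v \<in> V \<Longrightarrow> e v < n"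
  proof -
    obtain f where "bij_betw f V {0..<n}" using ex_bij_betw_finite_nat[OF fin] n_def by blast
    then show thesis by (intro that[of f]) (auto simp: bij_betw_def)
  qed
  \<comment> \<open>Depth of the top node first, ties broken by \<open>e\<close>. Since
    \<open>e v < n\<close>, division by \<open>n\<close> recovers the depth and the remainder
    recovers \<open>e v\<close>.\<close>
  define rank where "rank v = d (\<tau> v) * n + e v" for v
  have rank_d: "d (\<tau> u) \<le> d (\<tau> v)" if "u \<in> V" "v \<in> V" "rank u \<le> rank v" for u v
  proof -
    have "rank u div n = d (\<tau> u)" "rank v div n = d (\<tau> v)"
      using e(2)[OF that(1)] e(2)[OF that(2)] by (auto simp: rank_def)
    then show ?thesis using div_le_mono[OF that(3), of n] by simp
  qed
  have rank_mod: "rank v mod n = e v" if "v \<in> V" for v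
    using e(2)[OF that] by (simp add: rank_def)
  have inj: "inj_on rank V"
  proof (rule inj_onI)
    fix u v assume uv: "u \<in> V" "v \<in> V" "rank u = rank v"
    then have "e u = e v" using rank_mod by metis
    then show "u = v" using uv e(1) by (auto simp: inj_on_def)
  qed
  define B where "B v = {u \<in> bag (\<tau> v). rank u \<le> rank v}" for v
  have \<tau>T: "\<tau> v \<in> pverts T" "v \<in> bag (\<tau> v)" if "v \<in> V" for v using \<tau>(1)[OF that] by (auto simp: A_def)
  show thesis
  proof (rule that[of rank B, OF inj])
    fix v assume v: "v \<in> V"
    have "finite (bag (\<tau> v))" using bagV[OF \<tau>T(1)[OF v]] fin finite_subset by blast
    then have "card (B v) \<le> w"
      using w[OF \<tau>T(1)[OF v]] card_mono[of "bag (\<tau> v)" "B v"] by (auto simp: B_def)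
    then show "v \<in> B v \<and> B v \<subseteq> V \<and> card (B v) \<le> w"
      using bagV[OF \<tau>T(1)[OF v]] \<tau>T[OF v] by (auto simp: B_def)
  next
    fix u v assume "v \<in> V" "u \<in> B v"
    then show "rank u \<le> rank v" by (simp add: B_def)
  next
    fix u v w assume v: "v \<in> V" and uw: "u \<in> B v" "w \<in> B v" "rank u \<le> rank w"
    have V: "u \<in> V" "w \<in> V" using uw bagV[OF \<tau>T(1)[OF v]] by (auto simp: B_def)
    have "u \<in> bag (\<tau> w)"
      using key[of u w "\<tau> v"] V uw \<tau>T[OF v] rank_d[of u w] by (auto simp: A_def B_def)
    then show "u \<in> B w" using uw by (simp add: B_def)
  next
    fix K assume K: "K \<in> E" "K \<noteq> {}"
    have "\<forall>e \<in> E. \<exists>t \<in> pverts T. e \<subseteq> bag t" using td by (simp add: tree_decomposition_def)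
    then obtain t where t: "t \<in> pverts T" "K \<subseteq> bag t" using K(1) by blast
    have "K \<subseteq> V" using t(2) bagV[OF t(1)] by (rule order.trans)
    then have KV: "K \<subseteq> V" "finite K" using fin finite_subset by auto
    obtain v where v: "v \<in> K" "\<And>u. u \<in> K \<Longrightarrow> rank u \<le> rank v"
      using exists_max_on[OF KV(2) K(2), of rank] by blast
    have "u \<in> B v" if "u \<in> K" for u
    proof -
      have uv: "u \<in> V" "v \<in> V" "rank u \<le> rank v" using that v KV by blast+
      have "t \<in> A u" "t \<in> A v" using that v(1) t by (auto simp: A_def)
      then have "u \<in> bag (\<tau> v)" using key[OF uv(1,2)] rank_d[OF uv] by blast
      then show ?thesis using uv by (simp add: B_def)
    qed
    then show "\<exists>v \<in> K. K \<subseteq> B v" using v by blast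
  qed
qed

text \<open>The parent of \<open>u\<close> is the highest-ranked other element of
  \<open>B u\<close>, as in the elimination tree of a chordal graph. With \<open>v\<close> of lowest
  rank in \<open>U\<close>, the descendants \<open>C\<close> of \<open>v\<close> form one tree with
  root \<open>v\<close>. No bag of a variable in \<open>U - C\<close> meets \<open>C\<close>, so the
  remaining variables are treated separately and joined to it.\<close>

lemma exists_elim_forest:
  fixes rank :: "'v \<Rightarrow> nat" and B :: "'v \<Rightarrow> 'v set"
  assumes "finite U" "U \<noteq> {}" "inj_on rank V"
    and "U \<subseteq> V" "X \<subseteq> V" "\<And>x u. x \<in> X \<Longrightarrow> u \<in> U \<Longrightarrow> rank x < rank u"
    and "\<And>v. v \<in> V \<Longrightarrow> v \<in> B v"
    and "\<And>u v. v \<in> V \<Longrightarrow> u \<in> B v \<Longrightarrow> rank u \<le> rank v"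
    and "\<And>u v w. v \<in> V \<Longrightarrow> u \<in> B v \<Longrightarrow> w \<in> B v \<Longrightarrow> rank u \<le> rank w \<Longrightarrow> u \<in> B w"
    and "\<And>u. u \<in> U \<Longrightarrow> B u \<subseteq> U \<union> X"
  shows "\<exists>t. set_elim_forest t = U \<and> distinct (vtree_leaves (forest_vtree t)) \<and> forest_bags B t X"
  using assms(1,2,4-6,10)
proof (induction "card U" arbitrary: U X rule: less_induct)
  case (less U X)
  note inj = assms(3) and refl = assms(7) and le = assms(8) and chordal = assms(9)
  note X_less = less.prems(5) and bags = less.prems(6)
  obtain v where v: "v \<in> U" "\<And>u. u \<in> U \<Longrightarrow> rank v \<le> rank u"
    using arg_min_nat_lemma[of "\<lambda>v. v \<in> U" _ rank] less.prems(2) by (metis all_not_in_conv)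
  have rank_eq: "x = y" if "x \<in> U \<union> X" "y \<in> U \<union> X" "rank x = rank y" for x y
    using inj that less.prems by (auto simp: inj_on_def)
  have Bv: "B v \<subseteq> insert v X"
  proof
    fix u assume u: "u \<in> B v"
    then have "rank u \<le> rank v" "u \<in> U \<union> X" using le v bags less.prems by blast+
    then show "u \<in> insert v X" using v rank_eq[of u v] by force
  qed
  define parent where "parent w u \<longleftrightarrow> w \<in> B u - {u} \<and> (\<forall>x \<in> B u - {u}. rank x \<le> rank w)" for w u
  define R where "R = {(u, w). u \<in> U \<and> w \<in> U \<and> parent w u}"
  define C where "C = {u \<in> U. (u, v) \<in> R\<^sup>*}"
  \<comment> \<open>Chordality: apart from \<open>u\<close> itself, all of \<open>B u\<close> ranks
    at most as high as the parent and is therefore seen by the parent too.\<close>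
  have sub: "B u \<subseteq> insert u (B w)" if "parent w u" "u \<in> U" for u w
    using that chordal[of u _ w] less.prems by (auto simp: parent_def)
  have vC: "v \<in> C" "C \<subseteq> U" using v by (auto simp: C_def)
  have bagC: "B u \<subseteq> C \<union> B v" if "u \<in> C" for u
  proof -
    have "(u, v) \<in> R\<^sup>*" using that by (simp add: C_def)
    then show ?thesis
    proof (induction rule: converse_rtrancl_induct)
      case (step y z)
      have "y \<in> C" using step by (auto simp: C_def R_def intro: converse_rtrancl_into_rtrancl)
      then show ?case using step sub[of z y] by (auto simp: R_def)
    qed simp
  qed
  \<comment> \<open>If \<open>u\<close> outside \<open>C\<close> sees some \<open>w\<close> in
    \<open>C\<close>, then its parent \<open>y\<close> also sees \<open>w\<close>, is outside
    \<open>C\<close> as well and has smaller rank. \<open>y\<close> belongs to \<open>U\<close>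
    because it ranks at least as high as \<open>w\<close>, hence above all of
    \<open>X\<close>.\<close>
  have bagR: "B u \<inter> C = {}" if "u \<in> U - C" for u
    using that
  proof (induction "rank u" arbitrary: u rule: less_induct)
    case (less u)
    show ?case
    proof (rule ccontr)
      assume "B u \<inter> C \<noteq> {}"
      then obtain w where w: "w \<in> B u" "w \<in> C" by blast
      then have wu: "w \<in> B u - {u}" using less by auto
      have fin: "finite (B u)"
      proof (rule finite_imageD)
        have "rank ` B u \<subseteq> {..rank u}" using le less \<open>U \<subseteq> V\<close> by auto
        then show "finite (rank ` B u)" using finite_subset by blast
        show "inj_on rank (B u)" using bags[of u] less rank_eq by (intro inj_onI) blast
      qed
      obtain y where y: "parent y u"
      proof -
        have "B u - {u} \<noteq> {}" using wu by blast
        then show thesis using exists_max_on[of "B u - {u}" rank] fin that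
          unfolding parent_def by blast
      qed
      have "y \<in> U \<union> X" using y bags less by (auto simp: parent_def)
      moreover have "rank w \<le> rank y" using y wu by (auto simp: parent_def)
      ultimately have yU: "y \<in> U" using X_less[of y w] w vC by force
      then have uy: "(u, y) \<in> R" using y less by (auto simp: R_def)
      have "y \<notin> C" using uy less.prems by (auto simp: C_def intro: converse_rtrancl_into_rtrancl)
      moreover have "w \<in> B y" using sub[OF y] wu less by auto
      moreover have "rank y < rank u"
      proof -
        have "rank y \<le> rank u" "y \<noteq> u" using y le less \<open>U \<subseteq> V\<close> by (auto simp: parent_def)
        then show ?thesis using rank_eq[of y u] yU less by force
      qed
      ultimately show False using less.hyps[of y] yU w by auto
    qed
  qed
  define D where "D = C - {v}"
  have finC: "finite C" using vC less.prems finite_subset by blast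
  have cards: "card D < card U" "card (U - C) < card U"
  proof -
    have "D \<subset> U" "U - C \<subset> U" using vC by (auto simp: D_def)
    then show "card D < card U" "card (U - C) < card U"
      using psubset_card_mono[OF less.prems(1)] by blast+
  qed
  obtain tC where tC: "set_elim_forest tC = C" "distinct (vtree_leaves (forest_vtree tC))" "forest_bags B tC X"
  proof (cases "D = {}")
    case True
    then have "C = {v}" using vC by (auto simp: D_def)
    then show thesis using that[of "Leaf v"] Bv refl v less.prems by auto
  next
    case False
    have "\<exists>t. set_elim_forest t = D \<and> distinct (vtree_leaves (forest_vtree t)) \<and> forest_bags B t (B v)"
    proof (rule less.hyps[OF cards(1) _ False])
      show "finite D" using finC by (simp add: D_def)
      show "D \<subseteq> V" using vC less.prems by (auto simp: D_def)
      show "B v \<subseteq> V" using Bv v less.prems by auto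
      show "rank x < rank u" if "x \<in> B v" "u \<in> D" for x u
      proof -
        have "u \<in> U" "u \<noteq> v" using that vC by (auto simp: D_def)
        then have "rank v < rank u" using v rank_eq[of v u] by force
        then show ?thesis using le[of v x] that v less.prems by force
      qed
      show "B u \<subseteq> D \<union> B v" if "u \<in> D" for u
        using bagC[of u] that refl[of v] v less.prems by (auto simp: D_def)
    qed
    then obtain t where t: "set_elim_forest t = D" "distinct (vtree_leaves (forest_vtree t))"
      "forest_bags B t (B v)" by blast
    have "v \<in> B v" using refl v less.prems by auto
    then show thesis using that[of "Up v t"] t Bv vC by (auto simp: D_def)
  qed
  show ?case
  proof (cases "U = C")
    case True
    then show ?thesis using tC by blast
  next
    case False
    have "\<exists>t. set_elim_forest t = U - C \<and> distinct (vtree_leaves (forest_vtree t)) \<and> forest_bags B t X"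
    proof (rule less.hyps[OF cards(2)])
      show "U - C \<noteq> {}" using False vC by auto
      show "B u \<subseteq> U - C \<union> X" if "u \<in> U - C" for u
        using bagR[OF that] bags[of u] that by auto
    qed (use less.prems in auto)
    then obtain t where t: "set_elim_forest t = U - C" "distinct (vtree_leaves (forest_vtree t))"
      "forest_bags B t X" by blast
    have "set_elim_forest (Join tC t) = U" using t tC vC by auto
    moreover have "distinct (vtree_leaves (forest_vtree (Join tC t)))" using t tC by auto
    moreover have "forest_bags B (Join tC t) X" using t tC by simp
    ultimately show ?thesis by blast
  qed
qed

lemma exists_d_sdnnf_of_treewidth:
  fixes \<phi> :: "'v::infinite clauses"
  assumes nf: "monotone_nf \<phi>"
  shows "\<exists>C. d_sdnnf C \<and> var_gates C = \<Union>\<phi> \<and>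
    (\<forall>\<nu>. circuit_value C \<nu> \<longleftrightarrow> q = (\<exists>K \<in> \<phi>. \<forall>x \<in> K. \<nu> x = s)) \<and>
    circuit_size C \<le> 63 * 2 ^ (tw \<phi> + 1) * formula_size \<phi>"
proof -
  have fin: "finite (\<Union>\<phi>)" using nf by (simp add: monotone_nf_def)
  \<comment> \<open>An empty clause would be a subset of the nonempty clause that exists, against
    minimality.\<close>
  have ne: "K \<noteq> {}" if "K \<in> \<phi>" for K using nf that by (auto simp: monotone_nf_def)
  have "\<phi> \<noteq> {}" "\<Union>\<phi> \<noteq> {}" using nf by (auto simp: monotone_nf_def)
  have fin\<phi>: "finite \<phi>" "\<And>K. K \<in> \<phi> \<Longrightarrow> finite K"
    using fin finite_UnionD by (auto intro: finite_subset)
  obtain T :: "nat pair_pre_digraph" and bag where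
    td: "tree_decomposition (\<Union>\<phi>) \<phi> T bag" and wd: "td_width T bag = tw \<phi>"
  proof -
    have "\<exists>k. \<exists>(T :: nat pair_pre_digraph) bag. tree_decomposition (\<Union>\<phi>) \<phi> T bag \<and> td_width T bag = k"
      using tree_decomposition_exists[of \<phi> "\<Union>\<phi>"] by blast
    then have "\<exists>(T :: nat pair_pre_digraph) bag.
        tree_decomposition (\<Union>\<phi>) \<phi> T bag \<and> td_width T bag = tw \<phi>"
      unfolding tw_def hyp_treewidth_def by (rule LeastI_ex)
    then show thesis using that by blast
  qed
  \<comment> \<open>Safe despite truncated subtraction in \<open>td_width\<close>: a number is at
    most its predecessor plus one, also for 0.\<close>
  have bag_le: "card (bag t) \<le> tw \<phi> + 1" if "t \<in> pverts T" for t
  proof -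
    interpret pair_graph T using td by (simp add: tree_decomposition_def undirected_tree_def)
    have "card (bag t) \<le> Max ((\<lambda>t. card (bag t)) ` pverts T)"
      using that pair_finite_verts by (intro Max_ge) auto
    then show ?thesis using wd by (simp add: td_width_def)
  qed
  obtain rank :: "'v \<Rightarrow> nat" and B where B: "inj_on rank (\<Union>\<phi>)"
    "\<And>v. v \<in> \<Union>\<phi> \<Longrightarrow> v \<in> B v \<and> B v \<subseteq> \<Union>\<phi> \<and> card (B v) \<le> tw \<phi> + 1"
    "\<And>u v. v \<in> \<Union>\<phi> \<Longrightarrow> u \<in> B v \<Longrightarrow> rank u \<le> rank v"
    "\<And>u v w. v \<in> \<Union>\<phi> \<Longrightarrow> u \<in> B v \<Longrightarrow> w \<in> B v \<Longrightarrow> rank u \<le> rank w \<Longrightarrow> u \<in> B w"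
    "\<And>K. K \<in> \<phi> \<Longrightarrow> K \<noteq> {} \<Longrightarrow> \<exists>v \<in> K. K \<subseteq> B v"
    using exists_elimination_order[OF td fin bag_le] by blast
  have "\<exists>t. set_elim_forest t = \<Union>\<phi> \<and> distinct (vtree_leaves (forest_vtree t)) \<and> forest_bags B t {}"
  proof (rule exists_elim_forest[where V = "\<Union>\<phi>" and rank = rank])
    show "B u \<subseteq> \<Union>\<phi> \<union> {}" if "u \<in> \<Union>\<phi>" for u using B(2)[OF that] by simp
    show "v \<in> B v" if "v \<in> \<Union>\<phi>" for v using B(2)[OF that] by simp
  qed (fact fin B(1) B(3) B(4) \<open>\<Union>\<phi> \<noteq> {}\<close> subset_refl empty_subsetI | simp)+
  then obtain t where t: "set_elim_forest t = \<Union>\<phi>" "distinct (vtree_leaves (forest_vtree t))"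
    "forest_bags B t {}" by blast
  have "\<exists>C. d_sdnnf C \<and> var_gates C = \<Union>\<phi> \<and>
    (\<forall>\<nu>. circuit_value C \<nu> \<longleftrightarrow> q = (\<exists>K \<in> \<phi>. \<forall>x \<in> K. \<nu> x = s)) \<and>
    circuit_size C \<le> 63 * 2 ^ (tw \<phi> + 1) * card (\<Union>\<phi>)"
  proof (rule exists_d_sdnnf_of_forest[OF t(3,2,1)])
    show "card (B v) \<le> tw \<phi> + 1" if "v \<in> \<Union>\<phi>" for v using B(2)[OF that] by simp
    show "\<exists>v \<in> K. K \<subseteq> B v" if "K \<in> \<phi>" for K by (rule B(5)[OF that ne[OF that]])
  qed
  then obtain C where C: "d_sdnnf C" "var_gates C = \<Union>\<phi>"
    "\<forall>\<nu>. circuit_value C \<nu> \<longleftrightarrow> q = (\<exists>K \<in> \<phi>. \<forall>x \<in> K. \<nu> x = s)"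
    "circuit_size C \<le> 63 * 2 ^ (tw \<phi> + 1) * card (\<Union>\<phi>)"
    by (elim exE conjE)
  have "card (\<Union>\<phi>) \<le> formula_size \<phi>"
    unfolding formula_size_def using card_Union_le_sum_card by blast
  then have "circuit_size C \<le> 63 * 2 ^ (tw \<phi> + 1) * formula_size \<phi>"
    using C(4) by (meson le_trans mult_le_mono2)
  then show ?thesis using C(1-3) by (intro exI[of _ C]) simp
qed

section \<open>Tree decompositions built from parent functions\<close>

definition add_leaf :: "'n \<Rightarrow> 'n \<Rightarrow> 'n pair_pre_digraph \<Rightarrow> 'n pair_pre_digraph" where
  "add_leaf l q T = \<lparr>pverts = insert l (pverts T), parcs = insert (l, q) (insert (q, l) (parcs T))\<rparr>"

text \<open>A path between old vertices cannot visit \<open>l\<close>, as it would have to enter and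
  leave through \<open>q\<close>. A path from \<open>l\<close> is the arc to \<open>q\<close>
  followed by an old path, and reversal settles the paths to \<open>l\<close>.\<close>

lemma undirected_tree_add_leaf:
  assumes tree: "undirected_tree T" and q: "q \<in> pverts T" and l: "l \<notin> pverts T"
  shows "undirected_tree (add_leaf l q T)"
proof -
  interpret T: pair_graph T using tree by (simp add: undirected_tree_def)
  define G where "G = add_leaf l q T"
  have Gv: "pverts G = insert l (pverts T)" and Ga: "parcs G = insert (l, q) (insert (q, l) (parcs T))"
    by (simp_all add: G_def add_leaf_def)
  have lq: "l \<noteq> q" using q l by auto
  interpret G: pair_graph G
  proof
    show "symmetric (with_proj G)"
      using T.arcs_symmetric unfolding symmetric_def sym_def by (simp add: Ga)
  qed (use T.no_loops' T.pair_finite_verts T.pair_finite_arcs q lq in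
      \<open>auto simp: Gv Ga dest: T.in_arcsD1 T.in_arcsD2\<close>)
  have to_T: "T.apath s p t" if "G.apath s p t" "s \<noteq> l" "t \<noteq> l" for s p t
    using that
  proof (induction p arbitrary: s)
    case Nil
    then show ?case by (auto simp: G.apath_Nil_iff T.apath_Nil_iff Gv)
  next
    case (Cons e p)
    then have e: "e \<in> parcs G" "fst e = s" "G.apath (snd e) p t" "s \<notin> set (pawalk_verts (snd e) p)"
      by (auto simp: G.apath_Cons_iff)
    have "snd e \<noteq> l"
    proof
      assume sl: "snd e = l"
      then have sq: "s = q" using e(1,2) l lq by (cases e) (auto simp: Ga dest: T.in_arcsD2)
      have "p \<noteq> []" using e sl Cons.prems by (auto simp: G.apath_Nil_iff)
      then obtain e' p' where p: "p = e' # p'" by (cases p) auto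
      then have e': "e' \<in> parcs G" "fst e' = l" using e sl by (auto simp: G.apath_Cons_iff)
      have "snd e' = q" using e'  l lq by (cases e') (auto simp: Ga dest: T.in_arcsD1)
      moreover have "G.awalk (snd e') p' t" using e(3) p by (auto simp: G.awalk_Cons_iff G.apath_def)
      then have "snd e' \<in> set (pawalk_verts (snd e') p')" by (rule G.hd_in_awalk_verts)
      ultimately have "q \<in> set (pawalk_verts (snd e) p)" using p by simp
      then show False using e sq by simp
    qed
    moreover have "e \<in> parcs T" using e \<open>snd e \<noteq> l\<close> Cons.prems by (auto simp: Ga)
    ultimately show ?case using Cons.IH[of "snd e"] e Cons.prems by (simp add: T.apath_Cons_iff)
  qed
  have awalk_G: "G.awalk s p t" if "T.awalk s p t" for s p t
    using that by (auto simp: G.awalk_def T.awalk_def Gv Ga)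
  have to_G: "G.apath s p t" if "T.apath s p t" for s p t
    using that awalk_G by (auto simp: G.apath_def T.apath_def)
  have uniq_T: "\<exists>!p. T.apath s p t" if "s \<in> pverts T" "t \<in> pverts T" for s t
    using tree that by (simp add: undirected_tree_def)
  have apath_iff: "G.apath s p t \<longleftrightarrow> T.apath s p t" if "s \<in> pverts T" "t \<in> pverts T" for s p t
    using to_T to_G that l by metis
  have from_l: "\<exists>!p. G.apath l p t" if t: "t \<in> pverts T" for t
  proof -
    obtain p where p: "T.apath q p t" "\<And>p'. T.apath q p' t \<Longrightarrow> p' = p" using uniq_T[OF q t] by blast
    have "G.apath l ((l, q) # p) t"
    proof -
      have "set (pawalk_verts q p) \<subseteq> pverts T"
        using p(1) T.awalk_verts_in_verts unfolding T.apath_def by blast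
      then show ?thesis using to_G[OF p(1)] l by (auto simp: G.apath_Cons_iff Ga)
    qed
    moreover have "p' = (l, q) # p" if p': "G.apath l p' t" for p'
    proof -
      have "p' \<noteq> []" using p' t l by (auto simp: G.apath_Nil_iff)
      then obtain e p'' where e: "p' = e # p''" by (cases p') auto
      then have "e \<in> parcs G" "fst e = l" "G.apath (snd e) p'' t" using p' by (auto simp: G.apath_Cons_iff)
      moreover then have "e = (l, q)" using l lq by (cases e) (auto simp: Ga dest: T.in_arcsD1)
      ultimately show ?thesis using e p(2) apath_iff q t by auto
    qed
    ultimately show ?thesis by blast
  qed
  have "\<exists>!p. G.apath s p t" if st: "s \<in> pverts G" "t \<in> pverts G" for s t
  proof -
    consider (old) "s \<in> pverts T" "t \<in> pverts T" | (l) "s = l" "t = l"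
      | (out) "s = l" "t \<in> pverts T" | (in') "s \<in> pverts T" "t = l"
      using st by (auto simp: Gv)
    then show ?thesis
    proof cases
      case old
      then show ?thesis using uniq_T apath_iff by simp
    next
      case l
      then show ?thesis using G.apath_nonempty_ends[of l _ l] st
        by (intro ex1I[of _ "[]"]) (auto simp: G.apath_Nil_iff)
    next
      case out
      then show ?thesis using from_l by simp
    next
      case in'
      obtain p where p: "G.apath l p s" "\<And>p'. G.apath l p' s \<Longrightarrow> p' = p"
        using from_l[OF in'(1)] by (elim ex1E) blast
      show ?thesis
      proof (rule ex1I[of _ "rev_path p"])
        show "G.apath s (rev_path p) t" using p(1) in'(2) by simp
        fix p' assume "G.apath s p' t"
        then have "G.apath l (rev_path p') s" using in'(2) by simp
        then have "rev_path p' = p" by (rule p(2))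
        then show "p' = rev_path p" using rev_path_rev_path by metis
      qed
    qed
  qed
  moreover have "pair_graph G" by (rule G.pair_graph)
  ultimately have "undirected_tree G" by (auto simp: undirected_tree_def Gv)
  then show ?thesis by (simp add: G_def)
qed

definition parent_graph :: "'n set \<Rightarrow> 'n \<Rightarrow> ('n \<Rightarrow> 'n) \<Rightarrow> 'n pair_pre_digraph" where
  "parent_graph N r p = \<lparr>pverts = N, parcs = (\<Union>t \<in> N - {r}. {(t, p t), (p t, t)})\<rparr>"

text \<open>A node \<open>l\<close> that maximizes \<open>d\<close> among the nodes other than the
  root is nobody's parent. Without it there remains a rooted tree, to which \<open>l\<close> returns
  as a leaf.\<close>

lemma undirected_tree_parent_graph:
  assumes "rooted_tree N r p d"
  shows "undirected_tree (parent_graph N r p)"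
  using assms
proof (induction "card N" arbitrary: N)
  case 0
  then show ?case by (auto simp: rooted_tree_def)
next
  case (Suc n)
  have N: "finite N" "r \<in> N" using Suc.prems by (auto simp: rooted_tree_def)
  show ?case
  proof (cases "N = {r}")
    case True
    interpret pair_graph "\<lparr>pverts = {r}, parcs = {}\<rparr>"
      by unfold_locales (auto simp: symmetric_def sym_def)
    show ?thesis
      using pair_graph_axioms unfolding undirected_tree_def parent_graph_def True
      by (auto simp: apath_def awalk_def)
  next
    case False
    then have "N - {r} \<noteq> {}" using N by blast
    then obtain l where l: "l \<in> N - {r}" "\<And>t. t \<in> N - {r} \<Longrightarrow> d t \<le> d l"
      using exists_max_on[of "N - {r}" d] N by blast
    have not_parent: "p t \<noteq> l" if "t \<in> N - {r}" for t
      using l(2)[OF that] that Suc.prems by (force simp: rooted_tree_def)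
    have rt: "rooted_tree (N - {l}) r p d"
      using Suc.prems l not_parent by (auto simp: rooted_tree_def)
    have "undirected_tree (parent_graph (N - {l}) r p)"
      using Suc.hyps(1)[OF _ rt] Suc.hyps(2) N l by simp
    then have "undirected_tree (add_leaf l (p l) (parent_graph (N - {l}) r p))"
      using Suc.prems l not_parent
      by (intro undirected_tree_add_leaf) (auto simp: parent_graph_def rooted_tree_def)
    moreover have "add_leaf l (p l) (parent_graph (N - {l}) r p) = parent_graph N r p"
      using l by (auto simp: add_leaf_def parent_graph_def)
    ultimately show ?thesis by simp
  qed
qed

lemma connected_parent_graph:
  assumes rt: "rooted_tree N r p d" and top: "has_top r p A" and A: "A \<subseteq> N"
  shows "Digraph_Component.connected (with_proj (parent_graph N r p) \<restriction> A)"
proof -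
  define S where "S = parcs (mk_symmetric (with_proj (parent_graph N r p) \<restriction> A))"
  obtain t where t: "t \<in> A" "\<And>i. i \<in> A \<Longrightarrow> i \<noteq> t \<Longrightarrow> i \<noteq> r \<and> p i \<in> A"
    using top by (auto simp: has_top_def)
  have S: "(i, p i) \<in> S" "(p i, i) \<in> S" if "i \<in> A" "i \<noteq> t" for i
  proof -
    have "(i, p i) \<in> parcs (parent_graph N r p)" "p i \<in> A"
      using that t(2)[OF that] A by (auto simp: parent_graph_def)
    then have arc: "(i, p i) \<in> {e \<in> parcs (parent_graph N r p). fst e \<in> A \<and> snd e \<in> A}"
      using that by simp
    have S_eq: "S = (\<Union>e \<in> {e \<in> parcs (parent_graph N r p). fst e \<in> A \<and> snd e \<in> A}.
        {(fst e, snd e), (snd e, fst e)})"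
      by (simp add: S_def parcs_mk_symmetric)
    show "(i, p i) \<in> S" unfolding S_eq by (rule UN_I[OF arc]) simp
    show "(p i, i) \<in> S" unfolding S_eq by (rule UN_I[OF arc]) simp
  qed
  have reach: "(i, t) \<in> rtrancl_on A S \<and> (t, i) \<in> rtrancl_on A S" if "i \<in> A" for i
    using that
  proof (induction "d i" arbitrary: i rule: less_induct)
    case less
    show ?case
    proof (cases "i = t")
      case False
      then have "p i \<in> A" "i \<noteq> r" using t(2) less.prems by auto
      then have "d (p i) < d i" using rt less.prems A by (auto simp: rooted_tree_def)
      then have "(p i, t) \<in> rtrancl_on A S" "(t, p i) \<in> rtrancl_on A S"
        using less.hyps \<open>p i \<in> A\<close> by auto
      then show ?thesis
        using converse_rtrancl_on_into_rtrancl_on[OF S(1)[OF less.prems False] _ less.prems]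
          rtrancl_on_into_rtrancl_on[OF _ S(2)[OF less.prems False] less.prems] by blast
    qed (use t in simp)
  qed
  have "(i, j) \<in> rtrancl_on A S" if "i \<in> A" "j \<in> A" for i j
    using rtrancl_on_trans[of i t A S j] reach[OF that(1)] reach[OF that(2)] by simp
  then show ?thesis
    using t(1) unfolding Digraph_Component.connected_def strongly_connected_def reachable_def
      with_proj_simps pverts_mk_symmetric induce_subgraph_verts S_def by blast
qed

text \<open>Treewidth is defined by trees with nodes in \<open>nat\<close>; together with
  \<open>has_top_image\<close> this moves a tree whose nodes are sets of variables there.\<close>

lemma rooted_tree_image:
  assumes rt: "rooted_tree N r p d" and inj: "inj_on e N"
  shows "rooted_tree (e ` N) (e r) (e \<circ> p \<circ> inv_into N e) (d \<circ> inv_into N e)"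
proof -
  have inv: "inv_into N e (e t) = t" if "t \<in> N" for t using inj that by simp
  have "e (p t) \<in> e ` N \<and> d (inv_into N e (e (p t))) < d t" if "t \<in> N" "e t \<noteq> e r" for t
  proof -
    have "t \<in> N - {r}" using that by auto
    then have "p t \<in> N" "d (p t) < d t" using rt by (auto simp: rooted_tree_def)
    then show ?thesis using inv by simp
  qed
  then have "\<forall>s \<in> e ` N - {e r}. (e \<circ> p \<circ> inv_into N e) s \<in> e ` N \<and>
      (d \<circ> inv_into N e) ((e \<circ> p \<circ> inv_into N e) s) < (d \<circ> inv_into N e) s"
    using inv by (intro ballI) (elim DiffE imageE, simp)
  then show ?thesis using rt by (simp add: rooted_tree_def)
qed

lemma has_top_image:
  assumes "has_top r p A" "inj_on e N" "A \<subseteq> N" "r \<in> N"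
  shows "has_top (e r) (e \<circ> p \<circ> inv_into N e) (e ` A)"
proof -
  obtain t where t: "t \<in> A" "\<And>i. i \<in> A \<Longrightarrow> i \<noteq> t \<Longrightarrow> i \<noteq> r \<and> p i \<in> A"
    using assms(1) by (auto simp: has_top_def)
  have inv: "inv_into N e (e t) = t" if "t \<in> A" for t using assms that by auto
  have "e i \<noteq> e r \<and> e (p i) \<in> e ` A" if "i \<in> A" "e i \<noteq> e t" for i
  proof -
    have "i \<noteq> t" using that(2) by blast
    then have "i \<noteq> r" "p i \<in> A" using t(2)[OF that(1)] by auto
    moreover have "i \<in> N" using that(1) assms(3) by blast
    ultimately show ?thesis using assms(2,4) by (auto dest: inj_onD)
  qed
  then show ?thesis using t(1) inv unfolding has_top_def by (intro bexI[of _ "e t"]) auto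
qed

lemma hyp_treewidth_le:
  fixes N :: "'n set"
  assumes rt: "rooted_tree N r p d" and bagV: "\<And>t. t \<in> N \<Longrightarrow> bag t \<subseteq> V"
    and cover: "\<And>K. K \<in> E \<Longrightarrow> \<exists>t \<in> N. K \<subseteq> bag t"
    and top: "\<And>v. v \<in> V \<Longrightarrow> has_top r p {t \<in> N. v \<in> bag t}"
    and w: "\<And>t. t \<in> N \<Longrightarrow> card (bag t) \<le> w"
  shows "hyp_treewidth V E \<le> w"
proof -
  have N: "finite N" "r \<in> N" using rt by (auto simp: rooted_tree_def)
  then obtain e :: "'n \<Rightarrow> nat" where e: "inj_on e N"
    using ex_bij_betw_finite_nat[of N] bij_betw_imp_inj_on by blast
  let ?p = "e \<circ> p \<circ> inv_into N e"
  let ?T = "parent_graph (e ` N) (e r) ?p" and ?bag = "\<lambda>i. bag (inv_into N e i)"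
  have inv: "inv_into N e (e t) = t" if "t \<in> N" for t using e that by simp
  note rt' = rooted_tree_image[OF rt e]
  have pv: "pverts ?T = e ` N" by (simp add: parent_graph_def)
  have "tree_decomposition V E ?T ?bag"
    unfolding tree_decomposition_def pv
  proof (intro conjI ballI)
    show "undirected_tree ?T" by (rule undirected_tree_parent_graph[OF rt'])
  next
    fix t assume "t \<in> e ` N"
    then obtain s where "s \<in> N" "t = e s" by blast
    then show "?bag t \<subseteq> V" using bagV[of s] inv[of s] by simp
  next
    fix K assume "K \<in> E"
    then obtain t where "t \<in> N" "K \<subseteq> bag t" using cover by blast
    then show "\<exists>t \<in> e ` N. K \<subseteq> ?bag t" using inv by (intro bexI[of _ "e t"]) auto
  next
    fix v assume v: "v \<in> V"
    have eq: "{t \<in> e ` N. v \<in> ?bag t} = e ` {t \<in> N. v \<in> bag t}" using inv by auto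
    show "Digraph_Component.connected (with_proj ?T \<restriction> {t \<in> e ` N. v \<in> ?bag t})"
      unfolding eq
      by (rule connected_parent_graph[OF rt' has_top_image[OF top[OF v] e _ N(2)]]) auto
  qed
  then have "hyp_treewidth V E \<le> td_width ?T ?bag"
    unfolding hyp_treewidth_def by (intro Least_le) blast
  also have "td_width ?T ?bag \<le> w"
  proof -
    have "Max ((\<lambda>t. card (?bag t)) ` pverts ?T) \<le> w"
      unfolding pv using N w inv by (intro Max.boundedI) auto
    then show ?thesis unfolding td_width_def by simp
  qed
  finally show ?thesis .
qed

section \<open>Cuts of v-trees and treewidth\<close>

text \<open>Replacing nodes by their leaf sets merges a unary node with its child and, for distinct
  leaves, turns the tree order into inclusion.\<close>

definition vtree_sets :: "'v vtree \<Rightarrow> 'v set set" where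
  "vtree_sets T = (\<lambda>n. set (vtree_leaves n)) ` vtree_nodes T"

lemma vtree_sets_simps [simp]:
  "vtree_sets (VLeaf x) = {{x}}"
  "vtree_sets (VNode1 t) = insert (set (vtree_leaves t)) (vtree_sets t)"
  "vtree_sets (VNode2 t u) =
     insert (set (vtree_leaves t) \<union> set (vtree_leaves u)) (vtree_sets t \<union> vtree_sets u)"
  by (auto simp: vtree_sets_def)

lemma finite_vtree_sets: "finite (vtree_sets T)"
  by (induction T) auto

lemma vtree_leaves_in_sets: "set (vtree_leaves T) \<in> vtree_sets T"
  by (cases T) auto

lemma vtree_sets_subset: "A \<in> vtree_sets T \<Longrightarrow> A \<subseteq> set (vtree_leaves T)"
  by (induction T) auto

lemma vtree_leaves_ne: "vtree_leaves T \<noteq> []"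
  by (induction T) auto

lemma vtree_sets_ne: "A \<in> vtree_sets T \<Longrightarrow> A \<noteq> {}"
  using vtree_leaves_ne by (auto simp: vtree_sets_def)

lemma vtree_sets_laminar:
  assumes "distinct (vtree_leaves T)" "A \<in> vtree_sets T" "B \<in> vtree_sets T"
  shows "A \<subseteq> B \<or> B \<subseteq> A \<or> A \<inter> B = {}"
  using assms
proof (induction T)
  case (VNode2 t u)
  then have disj: "set (vtree_leaves t) \<inter> set (vtree_leaves u) = {}" by simp
  have cross: "A' \<inter> B' = {}" if "A' \<in> vtree_sets t" "B' \<in> vtree_sets u" for A' B'
    using vtree_sets_subset[OF that(1)] vtree_sets_subset[OF that(2)] disj by blast
  note sub = vtree_sets_subset[OF VNode2.prems(2)] vtree_sets_subset[OF VNode2.prems(3)]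
  consider "A = set (vtree_leaves (VNode2 t u))" | "B = set (vtree_leaves (VNode2 t u))"
    | "A \<in> vtree_sets t" "B \<in> vtree_sets t" | "A \<in> vtree_sets u" "B \<in> vtree_sets u"
    | "A \<in> vtree_sets t" "B \<in> vtree_sets u" | "A \<in> vtree_sets u" "B \<in> vtree_sets t"
    using VNode2.prems by auto
  then show ?case
  proof cases
    case 1
    then show ?thesis using sub(2) by simp
  next
    case 2
    then show ?thesis using sub(1) by simp
  next
    case 3
    then show ?thesis using VNode2.IH(1) VNode2.prems(1) by simp
  next
    case 4
    then show ?thesis using VNode2.IH(2) VNode2.prems(1) by simp
  next
    case 5
    then show ?thesis using cross by blast
  next
    case 6
    then show ?thesis using cross[of B A] by blast
  qed
next
  case (VNode1 t)
  have sub: "A \<subseteq> set (vtree_leaves t)" "B \<subseteq> set (vtree_leaves t)"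
    using vtree_sets_subset[OF VNode1.prems(2)] vtree_sets_subset[OF VNode1.prems(3)] by simp_all
  consider "A = set (vtree_leaves t)" | "B = set (vtree_leaves t)"
    | "A \<in> vtree_sets t" "B \<in> vtree_sets t" using VNode1.prems by auto
  then show ?case
  proof cases
    case 3
    then show ?thesis using VNode1.IH VNode1.prems(1) by simp
  qed (use sub in simp_all)
qed auto

lemma vtree_sets_split:
  assumes "distinct (vtree_leaves T)" "A \<in> vtree_sets T"
  shows "(\<exists>x. A = {x}) \<or> (\<exists>A1 \<in> vtree_sets T. \<exists>A2 \<in> vtree_sets T. A = A1 \<union> A2 \<and> A1 \<subset> A \<and> A2 \<subset> A)"
  using assms
proof (induction T)
  case (VNode1 t)
  have "vtree_sets (VNode1 t) = vtree_sets t" using vtree_leaves_in_sets[of t] by auto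
  then show ?case using VNode1 by simp
next
  case (VNode2 t u)
  have disj: "set (vtree_leaves t) \<inter> set (vtree_leaves u) = {}" using VNode2.prems by simp
  consider (top) "A = set (vtree_leaves t) \<union> set (vtree_leaves u)" | (left) "A \<in> vtree_sets t"
    | (right) "A \<in> vtree_sets u" using VNode2.prems by auto
  then show ?case
  proof cases
    case top
    have "set (vtree_leaves t) \<noteq> {}" "set (vtree_leaves u) \<noteq> {}" by (simp_all add: vtree_leaves_ne)
    then have "\<not> set (vtree_leaves u) \<subseteq> set (vtree_leaves t)" "\<not> set (vtree_leaves t) \<subseteq> set (vtree_leaves u)"
      using disj by (metis Int_absorb1, metis Int_absorb2)
    then have "set (vtree_leaves t) \<subset> A" "set (vtree_leaves u) \<subset> A" using top by auto
    moreover have "set (vtree_leaves t) \<in> vtree_sets (VNode2 t u)" "set (vtree_leaves u) \<in> vtree_sets (VNode2 t u)"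
      using vtree_leaves_in_sets by auto
    ultimately show ?thesis using top by blast
  next
    case left
    have "distinct (vtree_leaves t)" using VNode2.prems(1) by simp
    moreover have "vtree_sets t \<subseteq> vtree_sets (VNode2 t u)" by auto
    ultimately show ?thesis using VNode2.IH(1) left by (meson subsetD)
  next
    case right
    have "distinct (vtree_leaves u)" using VNode2.prems(1) by simp
    moreover have "vtree_sets u \<subseteq> vtree_sets (VNode2 t u)" by auto
    ultimately show ?thesis using VNode2.IH(2) right by (meson subsetD)
  qed
qed auto

definition cut :: "'v clauses \<Rightarrow> 'v set \<Rightarrow> 'v clauses" where
  "cut \<phi> A = {K \<in> \<phi>. K \<inter> A \<noteq> {} \<and> \<not> K \<subseteq> A}"

lemma card_Union_le_mult:
  assumes "finite Q" "\<And>K. K \<in> Q \<Longrightarrow> card K \<le> c"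
  shows "card (\<Union>Q) \<le> card Q * c"
proof -
  have "card (\<Union>Q) \<le> (\<Sum>K\<in>Q. card K)" by (rule card_Union_le_sum_card)
  also have "\<dots> \<le> (\<Sum>K\<in>Q. c)" using assms by (intro sum_mono) auto
  finally show ?thesis by simp
qed

text \<open>
  The bag of a node \<open>A\<close> contains every clause \<open>K\<close> for which \<open>A\<close> lies on a path between a leaf in
  \<open>K\<close> and the smallest node above all of \<open>K\<close>.
\<close>

lemma treewidth_le_cut:
  assumes nf: "monotone_nf \<phi>" and over: "vtree_over T (\<Union>\<phi>)"
    and c: "\<And>K. K \<in> \<phi> \<Longrightarrow> card K \<le> c"
    and m: "\<And>A. A \<in> vtree_sets T \<Longrightarrow> card (cut \<phi> A) \<le> m"
  shows "tw \<phi> \<le> (3 * m + 1) * c"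
proof -
  define F where "F = vtree_sets T"
  define V where "V = \<Union>\<phi>"
  have dist: "distinct (vtree_leaves T)" and leaves: "set (vtree_leaves T) = V"
    using over by (auto simp: vtree_over_def V_def)
  have finV: "finite V" and fin\<phi>: "finite \<phi>"
    using nf finite_UnionD by (auto simp: monotone_nf_def V_def)
  have ne: "K \<noteq> {}" if "K \<in> \<phi>" for K using nf that by (auto simp: monotone_nf_def)
  have finF: "finite F" and VF: "V \<in> F" and FV: "\<And>A. A \<in> F \<Longrightarrow> A \<subseteq> V" and Fne: "\<And>A. A \<in> F \<Longrightarrow> A \<noteq> {}"
    unfolding F_def using finite_vtree_sets[of T] vtree_leaves_in_sets[of T] vtree_sets_subset[of _ T]
      vtree_sets_ne[of _ T] leaves by blast+
  have lam: "A \<subseteq> B \<or> B \<subseteq> A \<or> A \<inter> B = {}" if "A \<in> F" "B \<in> F" for A B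
    using vtree_sets_laminar[OF dist] that by (simp add: F_def)
  have finA: "finite A" if "A \<in> F" for A using FV[OF that] finV finite_subset by blast
  \<comment> \<open>By laminarity, the members of \<open>F\<close> above a nonempty set form a
    chain. This yields both the parent \<open>p A\<close>, the least set strictly above
    \<open>A\<close>, and \<open>L K\<close>, the least set that includes the clause
    \<open>K\<close>.\<close>
  have smallest: "\<exists>P \<in> F. S P \<and> (\<forall>B \<in> F. S B \<longrightarrow> P \<subseteq> B)"
    if S: "\<And>B. S B \<Longrightarrow> K \<subseteq> B" "S V" "K \<noteq> {}" for S K
  proof -
    obtain P where P: "P \<in> F" "S P" "\<And>B. B \<in> F \<and> S B \<Longrightarrow> card P \<le> card B"
      using arg_min_nat_lemma[of "\<lambda>P. P \<in> F \<and> S P" V card] VF S(2) by blast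
    have "P \<subseteq> B" if B: "B \<in> F" "S B" for B
    proof -
      have "P \<inter> B \<noteq> {}" using S(1)[OF B(2)] S(1)[OF P(2)] S(3) by blast
      then consider "P \<subseteq> B" | "B \<subseteq> P" using lam[OF P(1) B(1)] by blast
      then show ?thesis
      proof cases
        case 2
        then have "B = P" using P(3)[of B] B card_seteq[OF finA[OF P(1)]] by blast
        then show ?thesis by simp
      qed
    qed
    then show ?thesis using P by blast
  qed
  have "\<exists>P \<in> F. A \<subset> P \<and> (\<forall>B \<in> F. A \<subset> B \<longrightarrow> P \<subseteq> B)" if "A \<in> F - {V}" for A
    using that FV Fne by (intro smallest[where K = A]) auto
  then obtain p where p: "\<And>A. A \<in> F - {V} \<Longrightarrow> p A \<in> F \<and> A \<subset> p A \<and> (\<forall>B \<in> F. A \<subset> B \<longrightarrow> p A \<subseteq> B)"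
    by metis
  have "\<exists>P \<in> F. K \<subseteq> P \<and> (\<forall>B \<in> F. K \<subseteq> B \<longrightarrow> P \<subseteq> B)" if "K \<in> \<phi>" for K
    using that ne[OF that] by (intro smallest[where K = K]) (auto simp: V_def)
  then obtain L where L: "\<And>K. K \<in> \<phi> \<Longrightarrow> L K \<in> F \<and> K \<subseteq> L K \<and> (\<forall>B \<in> F. K \<subseteq> B \<longrightarrow> L K \<subseteq> B)"
    by metis
  define bag where "bag A = {v. \<exists>K \<in> \<phi>. v \<in> K \<and> K \<inter> A \<noteq> {} \<and> A \<subseteq> L K}" for A
  have bagI: "v \<in> bag A" if "K \<in> \<phi>" "v \<in> K" "K \<inter> A \<noteq> {}" "A \<subseteq> L K" for v A K
    using that by (auto simp: bag_def)
  have "hyp_treewidth V \<phi> \<le> (3 * m + 1) * c"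
  proof (rule hyp_treewidth_le)
    show "rooted_tree F V p (\<lambda>A. card (V - A))"
      unfolding rooted_tree_def
    proof (intro conjI ballI finF VF)
      fix A assume A: "A \<in> F - {V}"
      then show "p A \<in> F" using p by blast
      have "V - p A \<subset> V - A" using p[OF A] FV[of "p A"] by blast
      then show "card (V - p A) < card (V - A)" using finV by (intro psubset_card_mono) auto
    qed
  next
    fix A assume "A \<in> F"
    show "bag A \<subseteq> V" by (auto simp: bag_def V_def)
  next
    fix K assume K: "K \<in> \<phi>"
    have "K \<subseteq> bag (L K)" using L[OF K] bagI[OF K] by blast
    then show "\<exists>A \<in> F. K \<subseteq> bag A" using L[OF K] by blast
  next
    fix v assume "v \<in> V"
    then obtain K0 where K0: "K0 \<in> \<phi>" "v \<in> K0" by (auto simp: V_def)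
    define N where "N = {A \<in> F. v \<in> bag A}"
    have LN: "L K \<in> N" if "K \<in> \<phi>" "v \<in> K" for K
      using L[OF that(1)] that bagI[of K v "L K"] by (auto simp: N_def)
    have "finite N" "N \<noteq> {}" using finF LN[OF K0] by (auto simp: N_def)
    \<comment> \<open>The largest node whose bag holds \<open>v\<close> is the top. By maximality it
      equals \<open>L K'\<close> for a clause \<open>K'\<close> through \<open>v\<close>.\<close>
    then obtain P where P: "P \<in> N" "\<And>A. A \<in> N \<Longrightarrow> card A \<le> card P"
      using exists_max_on[of N card] by blast
    obtain K' where K': "K' \<in> \<phi>" "v \<in> K'" "P \<subseteq> L K'" using P(1) by (auto simp: N_def bag_def)
    have PL: "P = L K'"
      using P(2)[OF LN[OF K'(1,2)]] K'(3) L[OF K'(1)] finA by (intro card_seteq) auto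
    have "A \<noteq> V \<and> p A \<in> N" if A: "A \<in> N" "A \<noteq> P" for A
    proof -
      obtain K where K: "K \<in> \<phi>" "v \<in> K" "K \<inter> A \<noteq> {}" "A \<subseteq> L K" and AF: "A \<in> F"
        using A(1) by (auto simp: N_def bag_def)
      have *: "A \<noteq> V \<and> p A \<in> N" if J: "J \<in> \<phi>" "v \<in> J" "A \<subset> L J" "J \<inter> A \<noteq> {}" for J
      proof -
        have AV: "A \<in> F - {V}" using AF J(3) FV[of "L J"] L[OF J(1)] by auto
        then have "p A \<subseteq> L J" "A \<subset> p A" "p A \<in> F" using p[OF AV] L[OF J(1)] J(3) by auto
        then show ?thesis using AV J bagI[of J v "p A"] by (auto simp: N_def)
      qed
      show ?thesis
      proof (cases "A = L K")
        case False
        then show ?thesis using *[of K] K by blast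
      next
        \<comment> \<open>At \<open>A = L K\<close> the clause \<open>K\<close> reaches no higher.
          But then \<open>v\<close> lies in \<open>A\<close>, so the clause \<open>K'\<close> of the
          top meets \<open>A\<close> and leads on to the parent.\<close>
        case True
        then have "v \<in> A" "v \<in> P" using K L[OF K(1)] K' L[OF K'(1)] PL by auto
        moreover have "\<not> P \<subset> A" using P(2)[OF A(1)] finA[OF AF] psubset_card_mono leD by blast
        moreover have "P \<in> F" using P(1) by (simp add: N_def)
        ultimately have "A \<subset> P" using lam[OF AF \<open>P \<in> F\<close>] A(2) by blast
        then show ?thesis using *[of K'] K' PL \<open>v \<in> A\<close> by blast
      qed
    qed
    then show "has_top V p {A \<in> F. v \<in> bag A}"
      unfolding has_top_def N_def[symmetric] using P(1) by blast
  next
    fix A assume A: "A \<in> F"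
    have fincut: "finite (cut \<phi> B)" for B using fin\<phi> by (simp add: cut_def)
    have mF: "card (cut \<phi> B) \<le> m" if "B \<in> F" for B using m that by (simp add: F_def)
    \<comment> \<open>A clause \<open>K\<close> in the bag of an inner node meets one of the two
      children and is contained in neither, since otherwise \<open>L K\<close> would be smaller than
      \<open>A\<close>. So three cuts suffice. At a leaf the clause is cut by \<open>A\<close> or is
      the unit clause \<open>A\<close> itself, which accounts for the extra 1.\<close>
    obtain Q where Q: "finite Q" "Q \<subseteq> \<phi>" "card Q \<le> 3 * m + 1" "bag A \<subseteq> \<Union>Q"
    proof -
      consider (single) x where "A = {x}"
        | (split) A1 A2 where "A1 \<in> F" "A2 \<in> F" "A = A1 \<union> A2" "A1 \<subset> A" "A2 \<subset> A"
        using vtree_sets_split[OF dist A[unfolded F_def], folded F_def] by (elim disjE exE bexE conjE)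
      then show thesis
      proof cases
        case single
        let ?Q = "cut \<phi> A \<union> ({A} \<inter> \<phi>)"
        have "bag A \<subseteq> \<Union>?Q"
        proof
          fix v assume "v \<in> bag A"
          then obtain K where K: "K \<in> \<phi>" "v \<in> K" "K \<inter> A \<noteq> {}" by (auto simp: bag_def)
          then have "K \<in> ?Q" using single by (auto simp: cut_def)
          then show "v \<in> \<Union>?Q" using K by blast
        qed
        moreover have "card ?Q \<le> 3 * m + 1"
        proof -
          have "card ({A} \<inter> \<phi>) \<le> 1" using card_mono[of "{A}" "{A} \<inter> \<phi>"] by simp
          then show ?thesis using card_Un_le[of "cut \<phi> A" "{A} \<inter> \<phi>"] mF[OF A] by linarith
        qed
        ultimately show thesis using that[of ?Q] fincut by (auto simp: cut_def)
      next
        case split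
        let ?Q = "cut \<phi> A \<union> cut \<phi> A1 \<union> cut \<phi> A2"
        have "bag A \<subseteq> \<Union>?Q"
        proof
          fix v assume "v \<in> bag A"
          then obtain K where K: "K \<in> \<phi>" "v \<in> K" "K \<inter> A \<noteq> {}" "A \<subseteq> L K" by (auto simp: bag_def)
          have "\<not> K \<subseteq> A1" "\<not> K \<subseteq> A2" using L[OF K(1)] K(4) split by blast+
          then have "K \<in> ?Q" using split K by (auto simp: cut_def)
          then show "v \<in> \<Union>?Q" using K by blast
        qed
        moreover have "card ?Q \<le> 3 * m + 1"
          using card_Un_le[of "cut \<phi> A \<union> cut \<phi> A1" "cut \<phi> A2"] card_Un_le[of "cut \<phi> A" "cut \<phi> A1"]
            mF[OF A] mF[OF split(1)] mF[OF split(2)] by linarith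
        ultimately show thesis using that[of ?Q] fincut by (auto simp: cut_def)
      qed
    qed
    have "finite (\<Union>Q)" using Q finV finite_subset[of "\<Union>Q" V] by (auto simp: V_def)
    then have "card (bag A) \<le> card (\<Union>Q)" using Q by (intro card_mono) auto
    also have "\<dots> \<le> card Q * c" using Q c by (intro card_Union_le_mult) auto
    also have "\<dots> \<le> (3 * m + 1) * c" using Q by (intro mult_le_mono1) auto
    finally show "card (bag A) \<le> (3 * m + 1) * c" .
  qed
  then show ?thesis by (simp add: tw_def V_def)
qed

section \<open>Scattered sets of clauses\<close>

text \<open>The connecting clause \<open>L\<close> may be \<open>K\<close> or \<open>K'\<close>, so
  two clauses with a common variable touch.\<close>

definition touch :: "'v clauses \<Rightarrow> 'v set \<Rightarrow> 'v set \<Rightarrow> bool" where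
  "touch \<phi> K K' \<longleftrightarrow> (\<exists>L \<in> \<phi>. L \<inter> K \<noteq> {} \<and> L \<inter> K' \<noteq> {})"

definition scattered :: "'v clauses \<Rightarrow> 'v clauses \<Rightarrow> bool" where
  "scattered \<phi> I \<longleftrightarrow> (\<forall>K \<in> I. \<forall>K' \<in> I. touch \<phi> K K' \<longrightarrow> K = K')"

lemma card_UN_le_mult:
  assumes "finite A" "card A \<le> a" "\<And>x. x \<in> A \<Longrightarrow> card (f x) \<le> b"
  shows "card (\<Union>x\<in>A. f x) \<le> a * b"
proof -
  have "card (\<Union>x\<in>A. f x) \<le> (\<Sum>x\<in>A. card (f x))" using assms(1) by (rule card_UN_le)
  also have "\<dots> \<le> (\<Sum>x\<in>A. b)" using assms(3) by (rule sum_mono)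
  also have "\<dots> \<le> a * b" using assms(2) by simp
  finally show ?thesis .
qed

text \<open>In a largest scattered subset of \<open>Q\<close>, every clause of \<open>Q\<close> is
  touched by a member. A member touches at most \<open>c ^ 4\<close> clauses: pick a variable of it,
  a clause through that variable, a variable of that clause and a clause through the latter.\<close>

lemma exists_scattered:
  assumes fin: "finite \<phi>" "\<And>K. K \<in> \<phi> \<Longrightarrow> finite K" and ne: "\<And>K. K \<in> \<phi> \<Longrightarrow> K \<noteq> {}"
    and ar: "\<And>K. K \<in> \<phi> \<Longrightarrow> card K \<le> c"
    and deg: "\<And>v. v \<in> \<Union>\<phi> \<Longrightarrow> card {K \<in> \<phi>. v \<in> K} \<le> c"
    and Q: "Q \<subseteq> \<phi>"
  shows "\<exists>I \<subseteq> Q. scattered \<phi> I \<and> card Q \<le> card I * c ^ 4"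
proof -
  have finQ: "finite Q" using Q fin finite_subset by blast
  let ?S = "{I. I \<subseteq> Q \<and> scattered \<phi> I}"
  have "finite ?S" using finQ by simp
  moreover have "{} \<in> ?S" by (simp add: scattered_def)
  ultimately obtain I where I: "I \<subseteq> Q" "scattered \<phi> I" "\<And>J. J \<subseteq> Q \<Longrightarrow> scattered \<phi> J \<Longrightarrow> card J \<le> card I"
    using exists_max_on[of ?S card] by blast
  have finI: "finite I" using I(1) finQ finite_subset by blast
  have sym: "touch \<phi> K K' \<longleftrightarrow> touch \<phi> K' K" for K K' by (auto simp: touch_def)
  have refl: "touch \<phi> K K" if "K \<in> \<phi>" for K using that ne[OF that] by (auto simp: touch_def)
  have near: "\<exists>K' \<in> I. touch \<phi> K' K" if K: "K \<in> Q" for K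
  proof (rule ccontr)
    assume far: "\<not> (\<exists>K' \<in> I. touch \<phi> K' K)"
    then have "K \<notin> I" using refl[of K] K Q by blast
    moreover have "scattered \<phi> (insert K I)" using I(2) far sym unfolding scattered_def by blast
    then have "card (insert K I) \<le> card I" using I(1,3) K by blast
    ultimately show False using finI by simp
  qed
  have nbhd: "card {K \<in> \<phi>. touch \<phi> K' K} \<le> c ^ 4" if K': "K' \<in> \<phi>" for K'
  proof -
    define N where "N x = {K \<in> \<phi>. x \<in> K}" for x
    have N: "finite (N x)" "card (N x) \<le> c" if "x \<in> K" "K \<in> \<phi>" for x K
      using fin that deg[of x] by (auto simp: N_def)
    have "card (\<Union>x\<in>K'. \<Union>L\<in>N x. \<Union>y\<in>L. N y) \<le> c * (c * (c * c))"
    proof (rule card_UN_le_mult)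
      fix x assume x: "x \<in> K'"
      show "card (\<Union>L\<in>N x. \<Union>y\<in>L. N y) \<le> c * (c * c)"
      proof (rule card_UN_le_mult)
        fix L assume "L \<in> N x"
        then have L: "L \<in> \<phi>" by (simp add: N_def)
        show "card (\<Union>y\<in>L. N y) \<le> c * c"
          using fin(2)[OF L] ar[OF L] N(2) L by (intro card_UN_le_mult) auto
      qed (use N[OF x K'] in auto)
    qed (use fin ar K' in auto)
    moreover have "{K \<in> \<phi>. touch \<phi> K' K} \<subseteq> (\<Union>x\<in>K'. \<Union>L\<in>N x. \<Union>y\<in>L. N y)"
      unfolding touch_def N_def by blast
    moreover have "finite (\<Union>x\<in>K'. \<Union>L\<in>N x. \<Union>y\<in>L. N y)"
      using fin(1) by (rule finite_subset[rotated]) (auto simp: N_def)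
    ultimately have "card {K \<in> \<phi>. touch \<phi> K' K} \<le> c * (c * (c * c))"
      using card_mono le_trans by meson
    then show ?thesis by (simp add: numeral_eq_Suc)
  qed
  have "Q \<subseteq> (\<Union>K'\<in>I. {K \<in> \<phi>. touch \<phi> K' K})" using near Q by blast
  moreover have "finite (\<Union>K'\<in>I. {K \<in> \<phi>. touch \<phi> K' K})" using finI fin by simp
  ultimately have "card Q \<le> card (\<Union>K'\<in>I. {K \<in> \<phi>. touch \<phi> K' K})" by (rule card_mono[rotated])
  also have "\<dots> \<le> card I * c ^ 4"
    using finI nbhd I(1) Q by (intro card_UN_le_mult) auto
  finally show ?thesis using I by blast
qed

text \<open>
  The restriction of the DNF to the variables of a scattered set of clauses is the DNF of
  this set, because any other clause has a variable outside.
\<close>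

lemma scattered_dnf_fun:
  assumes nf: "monotone_nf \<phi>" and I: "I \<subseteq> \<phi>" "scattered \<phi> I"
    and X: "\<And>K. K \<in> I \<Longrightarrow> K \<inter> X \<noteq> {} \<and> \<not> K \<subseteq> X" and S: "S \<subseteq> I" "S' \<subseteq> I"
  shows "dnf_fun \<phi> (\<lambda>z. if z \<in> X then z \<in> \<Union>S else z \<in> \<Union>S') \<longleftrightarrow> S \<inter> S' \<noteq> {}"
proof
  assume "S \<inter> S' \<noteq> {}"
  then obtain K where "K \<in> S" "K \<in> S'" by blast
  then show "dnf_fun \<phi> (\<lambda>z. if z \<in> X then z \<in> \<Union>S else z \<in> \<Union>S')"
    unfolding dnf_fun_def using I(1) S by (intro bexI[of _ K]) auto
next
  assume "dnf_fun \<phi> (\<lambda>z. if z \<in> X then z \<in> \<Union>S else z \<in> \<Union>S')"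
  then obtain L where L: "L \<in> \<phi>" "\<And>z. z \<in> L \<Longrightarrow> if z \<in> X then z \<in> \<Union>S else z \<in> \<Union>S'"
    by (auto simp: dnf_fun_def)
  have eq: "K = K'" if "K \<in> I" "K' \<in> I" "z \<in> M" "z \<in> K" "z' \<in> M" "z' \<in> K'" "M \<in> \<phi>" for K K' z z' M
    using I(2) that unfolding scattered_def touch_def by blast
  have mem: "\<exists>K \<in> I. z \<in> K" if "z \<in> L" for z using L(2)[OF that] S by (auto split: if_splits)
  have "L \<noteq> {}" using nf L(1) by (auto simp: monotone_nf_def)
  then obtain z0 K where K: "z0 \<in> L" "z0 \<in> K" "K \<in> I" using mem by blast
  have "L \<subseteq> K"
  proof
    fix z assume z: "z \<in> L"
    then obtain K' where "K' \<in> I" "z \<in> K'" using mem by blast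
    then show "z \<in> K" using eq[of K K' z0 L z] K z L(1) by blast
  qed
  then have LK: "L = K" using nf L(1) K(3) I(1) unfolding monotone_nf_def by blast
  \<comment> \<open>The clause \<open>K\<close> is cut by \<open>X\<close>; its variable inside
    \<open>X\<close> is governed by \<open>S\<close> and the one outside by \<open>S'\<close>, and
    scatteredness makes \<open>K\<close> the only member that contains either of them.\<close>
  obtain x y where xy: "x \<in> K" "x \<in> X" "y \<in> K" "y \<notin> X" using X[OF K(3)] by blast
  obtain K1 where "K1 \<in> S" "x \<in> K1" using L(2)[of x] LK xy by auto
  moreover obtain K2 where "K2 \<in> S'" "y \<in> K2" using L(2)[of y] LK xy by auto
  moreover have "K1 = K" if "K1 \<in> I" "x \<in> K1" for K1 using eq[of K1 K x K x] that K xy I(1) by blast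
  moreover have "K2 = K" if "K2 \<in> I" "y \<in> K2" for K2 using eq[of K2 K y K y] that K xy I(1) by blast
  ultimately show "S \<inter> S' \<noteq> {}" using S by blast
qed

section \<open>Structured circuits and cuts\<close>

definition mix :: "'v set \<Rightarrow> ('v \<Rightarrow> bool) \<Rightarrow> ('v \<Rightarrow> bool) \<Rightarrow> 'v \<Rightarrow> bool" where
  "mix X \<nu> \<nu>' = (\<lambda>z. if z \<in> X then \<nu> z else \<nu>' z)"

lemma wf_wires: "circuit C \<Longrightarrow> wf (wires C)"
  using finite_subset[of "wires C" "gates C \<times> gates C"] finite_acyclic_wf
  by (auto simp: circuit_def)

lemma inputs_in_gates: "circuit C \<Longrightarrow> g' \<in> inputs C g \<Longrightarrow> g' \<in> gates C"
  by (auto simp: circuit_def inputs_def)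

lemma gate_induct [consumes 2, case_names gate]:
  assumes "circuit C" "g \<in> gates C"
    and step: "\<And>g. g \<in> gates C \<Longrightarrow> (\<And>g'. g' \<in> inputs C g \<Longrightarrow> P g') \<Longrightarrow> P g"
  shows "P g"
  using wf_wires[OF assms(1)] assms(2)
proof (induction g rule: wf_induct_rule)
  case (less g)
  show ?case
  proof (rule step[OF less.prems])
    fix g' assume "g' \<in> inputs C g"
    then show "P g'" using less.IH inputs_in_gates[OF assms(1)] by (simp add: inputs_def)
  qed
qed

lemma Vars_inputs: "g' \<in> inputs C g \<Longrightarrow> Vars C g' \<subseteq> Vars C g"
  by (auto simp: Vars_def inputs_def intro: rtrancl_into_rtrancl)

lemma Vars_subset_inputs:
  assumes "kind C g \<noteq> VarGate"
  shows "Vars C g \<subseteq> (\<Union>g' \<in> inputs C g. Vars C g')"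
proof
  fix x assume x: "x \<in> Vars C g"
  then have "(x, g) \<in> (wires C)\<^sup>*" "x \<noteq> g" using assms by (auto simp: Vars_def var_gates_def)
  then obtain g' where "(x, g') \<in> (wires C)\<^sup>*" "(g', g) \<in> wires C" by (meson rtranclE)
  then show "x \<in> (\<Union>g' \<in> inputs C g. Vars C g')" using x by (auto simp: Vars_def inputs_def)
qed

lemma Vars_var_gate:
  assumes "circuit C" "g \<in> var_gates C"
  shows "Vars C g = {g}"
proof -
  have inp: "inputs C g = {}" using assms by (auto simp: circuit_def var_gates_def)
  have "x = g" if "(x, g) \<in> (wires C)\<^sup>*" for x
    using that
  proof (cases rule: rtranclE)
    case (step y)
    then show ?thesis using inp by (auto simp: inputs_def)
  qed simp
  then show ?thesis using assms by (auto simp: Vars_def)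
qed

lemma gate_value_cong:
  assumes "circuit C" "g \<in> gates C" "\<And>z. z \<in> Vars C g \<Longrightarrow> \<nu> z = \<nu>' z"
  shows "gate_value C \<nu> g = gate_value C \<nu>' g"
  using assms
proof (induction rule: gate_induct)
  case (gate g)
  have IH: "gate_value C \<nu> g' = gate_value C \<nu>' g'" if "g' \<in> inputs C g" for g'
    using gate.IH[OF that] gate.prems Vars_inputs[OF that] by blast
  have "\<nu> g = \<nu>' g" if "kind C g = VarGate"
    using gate that Vars_var_gate[OF assms(1), of g] by (auto simp: var_gates_def)
  then show ?case
    unfolding gate_value_unfold[OF assms(1), of _ g] using IH by (auto split: gate_kind.split)
qed

lemma vtree_children_sets:
  assumes "n \<in> vtree_nodes T" "k \<in> set (vtree_children n)"
  shows "set (vtree_leaves k) \<in> vtree_sets T"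
  using assms
proof (induction T)
  case (VNode1 t)
  then show ?case using vtree_leaves_in_sets[of t] by auto
next
  case (VNode2 t u)
  then show ?case using vtree_leaves_in_sets[of t] vtree_leaves_in_sets[of u] by auto
qed auto

lemma distinct_vtree_node:
  "n \<in> vtree_nodes T \<Longrightarrow> distinct (vtree_leaves T) \<Longrightarrow> distinct (vtree_leaves n)"
  by (induction T) auto

text \<open>If both children of the structuring node meet \<open>X\<close>, neither of them contains
  \<open>X\<close>, so by laminarity both lie inside \<open>X\<close>. Otherwise one child misses
  \<open>X\<close>, and so does the input below it.\<close>

lemma and_gate_split:
  assumes str: "structures T C" and X: "X \<in> vtree_sets T"
    and g: "g \<in> gates C" "kind C g = AndGate"
  shows "Vars C g \<subseteq> X \<or> Vars C g \<inter> X = {} \<or> (\<exists>g1. inputs C g = {g1}) \<or>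
    (\<exists>g1 g2. inputs C g = {g1, g2} \<and> Vars C g2 \<inter> X = {})"
proof (cases "inputs C g = {}")
  case True
  then show ?thesis using Vars_subset_inputs[of C g] g by auto
next
  case False
  have dist: "distinct (vtree_leaves T)" using str by (simp add: structures_def vtree_over_def)
  obtain gs n where gs: "set gs = inputs C g" and n: "n \<in> vtree_nodes T"
    and len: "length (vtree_children n) = length gs"
    and ch: "\<And>i. i < length gs \<Longrightarrow> Vars C (gs ! i) \<subseteq> set (vtree_leaves (vtree_children n ! i))"
    using str g False unfolding structures_def by metis
  show ?thesis
  proof (cases n)
    case (VLeaf x)
    then show ?thesis using len gs False by auto
  next
    case (VNode1 t)
    then obtain g1 where "gs = [g1]" using len by (cases gs) auto
    then have "inputs C g = {g1}" using gs by simp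
    then show ?thesis by blast
  next
    case (VNode2 t u)
    then obtain g1 g2 where g12: "gs = [g1, g2]" using len by (cases gs; cases "tl gs") auto
    have "Vars C (gs ! 0) \<subseteq> set (vtree_leaves (vtree_children n ! 0))"
      "Vars C (gs ! 1) \<subseteq> set (vtree_leaves (vtree_children n ! 1))"
      by (rule ch; simp add: g12)+
    then have V: "Vars C g1 \<subseteq> set (vtree_leaves t)" "Vars C g2 \<subseteq> set (vtree_leaves u)"
      by (simp_all add: g12 VNode2)
    have F: "set (vtree_leaves t) \<in> vtree_sets T" "set (vtree_leaves u) \<in> vtree_sets T"
      using vtree_children_sets[OF n] VNode2 by auto
    have disj: "set (vtree_leaves t) \<inter> set (vtree_leaves u) = {}"
      using distinct_vtree_node[OF n dist] VNode2 by simp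
    have inp: "inputs C g = {g1, g2}" using gs g12 by auto
    consider "set (vtree_leaves t) \<inter> X = {}" | "set (vtree_leaves u) \<inter> X = {}"
      | "set (vtree_leaves t) \<inter> X \<noteq> {}" "set (vtree_leaves u) \<inter> X \<noteq> {}" by blast
    then show ?thesis
    proof cases
      case 1
      then have "Vars C g1 \<inter> X = {}" "inputs C g = {g2, g1}" using V inp by auto
      then show ?thesis by blast
    next
      case 2
      then have "Vars C g2 \<inter> X = {}" using V by blast
      then show ?thesis using inp by blast
    next
      case 3
      then have "\<not> X \<subseteq> set (vtree_leaves t)" "\<not> X \<subseteq> set (vtree_leaves u)" using disj by blast+
      then have "set (vtree_leaves t) \<subseteq> X" "set (vtree_leaves u) \<subseteq> X"
        using vtree_sets_laminar[OF dist X F(1)] vtree_sets_laminar[OF dist X F(2)] 3 by blast+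
      then have "Vars C g1 \<subseteq> X" "Vars C g2 \<subseteq> X" using V by auto
      then have "Vars C g \<subseteq> X" using Vars_subset_inputs[of C g] g inp by auto
      then show ?thesis by blast
    qed
  qed
qed

lemma literal_gate_split:
  assumes "nnf C" "g \<in> gates C" "kind C g \<in> {VarGate, NotGate}"
  shows "Vars C g \<subseteq> X \<or> Vars C g \<inter> X = {}"
proof -
  have circ: "circuit C" using assms by (simp add: nnf_def)
  have "\<exists>x. Vars C g \<subseteq> {x}"
  proof (cases "kind C g")
    case VarGate
    then show ?thesis using Vars_var_gate[OF circ, of g] assms by (auto simp: var_gates_def)
  next
    case NotGate
    then have "card (inputs C g) = 1" "inputs C g \<subseteq> var_gates C"
      using assms circ by (auto simp: circuit_def nnf_def)
    then obtain x where "inputs C g = {x}" "x \<in> var_gates C" by (auto simp: card_1_singleton_iff)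
    then show ?thesis using Vars_subset_inputs[of C g] Vars_var_gate[OF circ, of x] NotGate by auto
  qed (use assms in auto)
  then show ?thesis by blast
qed

text \<open>
  Following true gates down from \<open>g\<close> until the variables lie on one side of the cut: the gates \<open>h\<close>
  index a cover of the models by rectangles.
\<close>

lemma exists_separating_gate:
  assumes nnf: "nnf C" and str: "structures T C" and X: "X \<in> vtree_sets T"
    and g: "g \<in> gates C" "gate_value C \<nu> g"
  shows "\<exists>h \<in> gates C. (Vars C h \<subseteq> X \<or> Vars C h \<inter> X = {}) \<and> gate_value C \<nu> h \<and>
    (\<forall>\<nu>'. (\<forall>z. z \<notin> X \<longrightarrow> \<nu>' z = \<nu> z) \<longrightarrow> gate_value C \<nu>' h \<longrightarrow> gate_value C \<nu>' g)"
proof -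
  have circ: "circuit C" using nnf by (simp add: nnf_def)
  note unfold = gate_value_unfold[OF circ]
  show ?thesis
    using circ g
  proof (induction rule: gate_induct)
    case (gate g)
    show ?case
    proof (cases "Vars C g \<subseteq> X \<or> Vars C g \<inter> X = {}")
      case True
      then show ?thesis using gate by blast
    next
      case False
      have descend: ?thesis if g1: "g1 \<in> inputs C g" "gate_value C \<nu> g1"
        and up: "\<And>\<nu>'. \<forall>z. z \<notin> X \<longrightarrow> \<nu>' z = \<nu> z \<Longrightarrow> gate_value C \<nu>' g1 \<Longrightarrow> gate_value C \<nu>' g" for g1
      proof -
        obtain h where h: "h \<in> gates C" "Vars C h \<subseteq> X \<or> Vars C h \<inter> X = {}" "gate_value C \<nu> h"
          "\<forall>\<nu>'. (\<forall>z. z \<notin> X \<longrightarrow> \<nu>' z = \<nu> z) \<longrightarrow> gate_value C \<nu>' h \<longrightarrow> gate_value C \<nu>' g1"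
          using gate.IH[OF g1] by (elim bexE conjE)
        show ?thesis using h(4) up by (intro bexI[OF _ h(1)] conjI h(2,3)) simp
      qed
      consider "kind C g \<in> {VarGate, NotGate}" | (disj) "kind C g = OrGate" | (conj) "kind C g = AndGate"
        by (cases "kind C g") auto
      then show ?thesis
      proof cases
        case 1
        then show ?thesis using literal_gate_split[OF nnf gate.hyps(1)] False by blast
      next
        case disj
        then obtain g1 where "g1 \<in> inputs C g" "gate_value C \<nu> g1"
          using gate.prems unfold[of \<nu> g] by auto
        then show ?thesis using disj unfold[of _ g] by (intro descend[of g1]) auto
      next
        case conj
        have true: "gate_value C \<nu> g'" if "g' \<in> inputs C g" for g'
          using gate.prems that unfold[of \<nu> g] conj by auto
        consider g1 where "inputs C g = {g1}"
          | g1 g2 where "inputs C g = {g1, g2}" "Vars C g2 \<inter> X = {}"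
          using and_gate_split[OF str X gate.hyps(1) conj] False by blast
        then show ?thesis
        proof cases
          case 1
          then show ?thesis using true conj unfold[of _ g] by (intro descend[of g1]) auto
        next
          case 2
          show ?thesis
          proof (rule descend[of g1])
            fix \<nu>' assume *: "\<forall>z. z \<notin> X \<longrightarrow> \<nu>' z = \<nu> z" "gate_value C \<nu>' g1"
            have "g2 \<in> gates C" using inputs_in_gates[OF circ, of g2 g] 2 by simp
            then have "gate_value C \<nu>' g2 = gate_value C \<nu> g2"
              using * 2 by (intro gate_value_cong[OF circ]) auto
            then show "gate_value C \<nu>' g" using * 2 true[of g2] conj unfold[of \<nu>' g] by simp
          qed (use 2 true in auto)
        qed
      qed
    qed
  qed
qed

text \<open>Send each model to a separating gate. If two models share the gate, their mixtures are
  models: the gate stays true because it sees only one side of the cut, and then the output is true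
  because only variables of \<open>X\<close> were changed. So the map is injective on a fooling
  set.\<close>

lemma fooling_set_bound:
  assumes sd: "sdnnf C" and str: "structures T C" and X: "X \<in> vtree_sets T"
    and models: "\<And>j. j \<in> J \<Longrightarrow> circuit_value C (\<nu> j)"
    and fool: "\<And>i j. i \<in> J \<Longrightarrow> j \<in> J \<Longrightarrow> i \<noteq> j \<Longrightarrow>
      \<not> circuit_value C (mix X (\<nu> i) (\<nu> j)) \<or> \<not> circuit_value C (mix X (\<nu> j) (\<nu> i))"
  shows "card J \<le> card (gates C)"
proof -
  have nnf: "nnf C" and circ: "circuit C" using sd by (auto simp: sdnnf_def nnf_def)
  have fin: "finite (gates C)" and out: "output_gate C \<in> gates C" using circ by (auto simp: circuit_def)
  define sep where "sep j h \<longleftrightarrow> h \<in> gates C \<and> (Vars C h \<subseteq> X \<or> Vars C h \<inter> X = {}) \<and>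
    gate_value C (\<nu> j) h \<and>
    (\<forall>\<nu>'. (\<forall>z. z \<notin> X \<longrightarrow> \<nu>' z = \<nu> j z) \<longrightarrow> gate_value C \<nu>' h \<longrightarrow> circuit_value C \<nu>')" for j h
  have "\<exists>h. sep j h" if "j \<in> J" for j
    using exists_separating_gate[OF nnf str X out, of "\<nu> j"] models[OF that]
    unfolding sep_def circuit_value_def by (simp add: Bex_def)
  then obtain h where sep: "\<And>j. j \<in> J \<Longrightarrow> sep j (h j)" by metis
  have h: "h j \<in> gates C" "Vars C (h j) \<subseteq> X \<or> Vars C (h j) \<inter> X = {}" "gate_value C (\<nu> j) (h j)"
    "\<And>\<nu>'. \<forall>z. z \<notin> X \<longrightarrow> \<nu>' z = \<nu> j z \<Longrightarrow> gate_value C \<nu>' (h j) \<Longrightarrow> circuit_value C \<nu>'"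
    if "j \<in> J" for j
    using sep[OF that] unfolding sep_def by simp_all
  have crossing: "circuit_value C (mix X (\<nu> i) (\<nu> j))" if ij: "i \<in> J" "j \<in> J" "h i = h j" for i j
  proof (rule h(4)[OF ij(2)])
    show "\<forall>z. z \<notin> X \<longrightarrow> mix X (\<nu> i) (\<nu> j) z = \<nu> j z" by (simp add: mix_def)
    show "gate_value C (mix X (\<nu> i) (\<nu> j)) (h j)"
      using h(2)[OF ij(2)]
    proof
      assume "Vars C (h j) \<subseteq> X"
      then have "gate_value C (mix X (\<nu> i) (\<nu> j)) (h j) = gate_value C (\<nu> i) (h j)"
        by (intro gate_value_cong[OF circ h(1)[OF ij(2)]]) (auto simp: mix_def)
      then show ?thesis using h(3)[OF ij(1)] ij(3) by simp
    next
      assume "Vars C (h j) \<inter> X = {}"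
      then have "gate_value C (mix X (\<nu> i) (\<nu> j)) (h j) = gate_value C (\<nu> j) (h j)"
        by (intro gate_value_cong[OF circ h(1)[OF ij(2)]]) (auto simp: mix_def)
      then show ?thesis using h(3)[OF ij(2)] by simp
    qed
  qed
  have "inj_on h J"
    using crossing fool by (intro inj_onI) metis
  then show ?thesis using h(1) fin by (intro card_inj_on_le[of h]) auto
qed

section \<open>The rank bound for deterministic circuits\<close>

interpretation fun_space: vector_space "\<lambda>(c::real) (f :: 'a \<Rightarrow> real) x. c * f x"
  by unfold_locales (auto simp: fun_eq_iff algebra_simps)

lemma sum_fun_apply: "(\<Sum>a\<in>A. f a) x = (\<Sum>a\<in>A. f a x :: real)"
  by (induction A rule: infinite_finite_induct) auto

text \<open>
  For a fixed assignment outside \<open>X\<close>, the value of a gate is a linear combination of the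
  values of the gates that depend on \<open>X\<close> only: determinism turns or into a sum, and one factor of
  each and is a constant.
\<close>

lemma gate_value_in_span:
  assumes nnf: "nnf C" and str: "structures T C" and det: "deterministic C" and X: "X \<in> vtree_sets T"
    and g: "g \<in> gates C"
  shows "(\<lambda>\<mu>. of_bool (gate_value C (mix X \<mu> \<nu>) g)) \<in> fun_space.span
    (insert (\<lambda>_. 1) ((\<lambda>h \<mu>. of_bool (gate_value C (mix X \<mu> (\<lambda>_. False)) h)) ` gates C))"
    (is "?f g \<in> fun_space.span ?W")
proof -
  have circ: "circuit C" using nnf by (simp add: nnf_def)
  note unfold = gate_value_unfold[OF circ]
  have const: "(\<lambda>_. a) \<in> fun_space.span ?W" for a :: real
    using fun_space.span_scale[OF fun_space.span_base[of "\<lambda>_. 1" ?W], of a] by simp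
  show ?thesis
    using circ g
  proof (induction rule: gate_induct)
    case (gate g)
    consider (in') "Vars C g \<subseteq> X" | (out) "Vars C g \<inter> X = {}"
      | (both) "\<not> (Vars C g \<subseteq> X \<or> Vars C g \<inter> X = {})" by blast
    then show ?case
    proof cases
      \<comment> \<open>A gate inside \<open>X\<close> ignores \<nu>, so the generators may fix the
        value \<open>False\<close> outside \<open>X\<close>; thus one generating set serves all
        \<nu>.\<close>
      case in'
      then have "?f g = (\<lambda>\<mu>. of_bool (gate_value C (mix X \<mu> (\<lambda>_. False)) g))"
        by (intro ext arg_cong[of _ _ of_bool] gate_value_cong[OF circ gate.hyps(1)]) (auto simp: mix_def)
      then show ?thesis using gate.hyps(1) by (auto intro: fun_space.span_base)
    next
      case out
      then have "?f g = (\<lambda>_. of_bool (gate_value C \<nu> g))"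
        by (intro ext arg_cong[of _ _ of_bool] gate_value_cong[OF circ gate.hyps(1)]) (auto simp: mix_def)
      then show ?thesis using const by simp
    next
      case both
      consider "kind C g \<in> {VarGate, NotGate}" | (disj) "kind C g = OrGate" | (conj) "kind C g = AndGate"
        by (cases "kind C g") auto
      then show ?thesis
      proof cases
        case 1
        then show ?thesis using literal_gate_split[OF nnf gate.hyps(1)] both by blast
      next
        case disj
        have fin: "finite (inputs C g)"
          using circ inputs_in_gates[OF circ] finite_subset[of "inputs C g" "gates C"]
          by (auto simp: circuit_def)
        have "?f g \<mu> = (\<Sum>g'\<in>inputs C g. ?f g' \<mu>)" for \<mu>
        proof (cases "\<exists>g1 \<in> inputs C g. gate_value C (mix X \<mu> \<nu>) g1")
          case True
          then obtain g1 where g1: "g1 \<in> inputs C g" "gate_value C (mix X \<mu> \<nu>) g1" by blast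
          have "\<not> gate_value C (mix X \<mu> \<nu>) g'" if "g' \<in> inputs C g" "g' \<noteq> g1" for g'
            using det gate.hyps(1) disj g1 that unfolding deterministic_def by blast
          then have "?f g' \<mu> = (if g' = g1 then 1 else 0)" if "g' \<in> inputs C g" for g'
            using that g1 by auto
          then have "(\<Sum>g'\<in>inputs C g. ?f g' \<mu>) = (\<Sum>g'\<in>inputs C g. if g' = g1 then 1 else 0)"
            by (intro sum.cong) auto
          also have "\<dots> = 1" using fin g1 by simp
          finally show ?thesis using True disj unfold[of _ g] by simp
        next
          case False
          then show ?thesis using disj unfold[of _ g] by simp
        qed
        then have "?f g = (\<Sum>g'\<in>inputs C g. ?f g')" by (intro ext) (simp add: sum_fun_apply)
        then show ?thesis using gate.IH by (simp only:) (intro fun_space.span_sum)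
      next
        case conj
        consider g1 where "inputs C g = {g1}"
          | g1 g2 where "inputs C g = {g1, g2}" "Vars C g2 \<inter> X = {}"
          using and_gate_split[OF str X gate.hyps(1) conj] both by blast
        then show ?thesis
        proof cases
          case 1
          then have "?f g = ?f g1" using conj unfold[of _ g] by simp
          then show ?thesis using gate.IH[of g1] 1 by simp
        next
          case 2
          have "g2 \<in> gates C" using inputs_in_gates[OF circ, of g2 g] 2 by simp
          then have "gate_value C (mix X \<mu> \<nu>) g2 = gate_value C \<nu> g2" for \<mu>
            using 2 by (intro gate_value_cong[OF circ]) (auto simp: mix_def)
          then have "?f g = (\<lambda>\<mu>. of_bool (gate_value C \<nu> g2) * ?f g1 \<mu>)"
            using 2 conj unfold[of _ g] by auto
          moreover have "?f g1 \<in> fun_space.span ?W" using gate.IH[of g1] 2 by simp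
          ultimately show ?thesis by (simp only:) (rule fun_space.span_scale)
        qed
      qed
    qed
  qed
qed

text \<open>
  The disjointness matrix of the subsets of \<open>I\<close> has full rank: up to complementing the row
  index it is the inclusion matrix, which is triangular.
\<close>

lemma disjointness_rank:
  fixes F :: "'i set \<Rightarrow> 'a \<Rightarrow> real"
  assumes finI: "finite I" and finW: "finite W"
    and span: "\<And>S. S \<subseteq> I \<Longrightarrow> F S \<in> fun_space.span W"
    and disj: "\<And>S S'. S \<subseteq> I \<Longrightarrow> S' \<subseteq> I \<Longrightarrow> F S' (x S) = of_bool (S \<inter> S' = {})"
  shows "2 ^ card I \<le> card W"
proof -
  have inj: "inj_on F (Pow I)"
  proof (rule inj_onI)
    have *: "S \<subseteq> S'" if "S \<in> Pow I" "S' \<in> Pow I" "F S = F S'" for S S'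
    proof -
      have "F S' (x (I - S')) = 1" using disj[of "I - S'" S'] that by auto
      then have "F S (x (I - S')) = 1" using that by simp
      then have "(I - S') \<inter> S = {}" using disj[of "I - S'" S] that by (auto split: if_splits)
      then show ?thesis using that by auto
    qed
    fix S S' assume "S \<in> Pow I" "S' \<in> Pow I" "F S = F S'"
    then show "S = S'" using *[of S S'] *[of S' S] by simp
  qed
  have "\<not> fun_space.dependent (F ` Pow I)"
  proof
    assume "fun_space.dependent (F ` Pow I)"
    then obtain u where u: "\<exists>f \<in> F ` Pow I. u f \<noteq> 0" "(\<Sum>f\<in>F ` Pow I. (\<lambda>y. u f * f y)) = 0"
      using fun_space.dependent_finite[of "F ` Pow I"] finI by auto
    define a where "a S = u (F S)" for S
    have lin: "(\<Sum>S\<in>Pow I. a S * F S y) = 0" for y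
    proof -
      have "(\<Sum>S\<in>Pow I. a S * F S y) = (\<Sum>f\<in>F ` Pow I. u f * f y)"
        by (simp add: sum.reindex[OF inj] a_def)
      also have "\<dots> = (\<Sum>f\<in>F ` Pow I. (\<lambda>y. u f * f y)) y" by (simp add: sum_fun_apply)
      finally show ?thesis using u(2) by simp
    qed
    \<comment> \<open>Evaluation at \<open>I - U\<close> keeps exactly the terms with
      \<open>S \<subseteq> U\<close>. That all these subset sums vanish forces \<open>a = 0\<close>
      by induction on the size of \<open>U\<close>.\<close>
    have sums: "(\<Sum>S\<in>Pow U. a S) = 0" if U: "U \<subseteq> I" for U
    proof -
      have "(\<Sum>S\<in>Pow I. a S * F S (x (I - U))) = (\<Sum>S\<in>Pow U. a S)"
      proof (rule sum.mono_neutral_cong_right)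
        show "a S * F S (x (I - U)) = a S" if "S \<in> Pow U" for S
          using that U disj[of "I - U" S] by auto
        show "\<forall>S \<in> Pow I - Pow U. a S * F S (x (I - U)) = 0"
          using U disj[of "I - U"] by auto
      qed (use U finI in auto)
      then show ?thesis using lin by simp
    qed
    have "a U = 0" if "U \<subseteq> I" for U
      using that
    proof (induction "card U" arbitrary: U rule: less_induct)
      case less
      have finU: "finite U" using less.prems finI finite_subset by blast
      have "a S = 0" if "S \<in> Pow U - {U}" for S
        using less.hyps[of S] that psubset_card_mono[OF finU, of S] less.prems by auto
      then have "(\<Sum>S\<in>Pow U. a S) = a U"
        using finU by (subst sum.remove[of _ U]) auto
      then show ?case using sums[OF less.prems] by simp
    qed
    then show False using u(1) by (auto simp: a_def)
  qed
  moreover have "F ` Pow I \<subseteq> fun_space.span W" using span by auto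
  ultimately have "card (F ` Pow I) \<le> card W"
    using fun_space.independent_span_bound[OF finW] by blast
  then show ?thesis using card_image[OF inj] finI by (simp add: card_Pow)
qed

section \<open>Bounds in terms of treewidth\<close>

text \<open>\<open>X\<close> has the largest cut, so its size bounds all the cuts in
  \<open>treewidth_le_cut\<close>; thinning this cut to a scattered set costs the factor
  \<open>c ^ 4\<close>.\<close>

lemma exists_scattered_cut:
  assumes nf: "monotone_nf \<phi>" and ar: "arity \<phi> \<le> c" and deg: "degree \<phi> \<le> c"
    and over: "vtree_over T (\<Union>\<phi>)"
  obtains X I where "X \<in> vtree_sets T" "I \<subseteq> cut \<phi> X" "scattered \<phi> I"
    "tw \<phi> \<le> (3 * (card I * c ^ 4) + 1) * c"
proof -
  have finV: "finite (\<Union>\<phi>)" and fin\<phi>: "finite \<phi>"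
    using nf finite_UnionD by (auto simp: monotone_nf_def)
  have finK: "finite K" if "K \<in> \<phi>" for K using that finV by (meson Union_upper finite_subset)
  have ne: "K \<noteq> {}" if "K \<in> \<phi>" for K using nf that by (auto simp: monotone_nf_def)
  have cardK: "card K \<le> c" if "K \<in> \<phi>" for K
  proof -
    have "card K \<le> Max (card ` \<phi>)" using fin\<phi> that by (intro Max_ge) auto
    then show ?thesis using ar by (simp add: arity_def hyp_arity_def)
  qed
  have degv: "card {K \<in> \<phi>. v \<in> K} \<le> c" if "v \<in> \<Union>\<phi>" for v
  proof -
    have "card {K \<in> \<phi>. v \<in> K} \<le> Max ((\<lambda>v. card {K \<in> \<phi>. v \<in> K}) ` \<Union>\<phi>)"
      using finV that by (intro Max_ge) auto
    then show ?thesis using deg by (simp add: degree_def hyp_degree_def)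
  qed
  have "vtree_sets T \<noteq> {}" using vtree_leaves_in_sets by blast
  then obtain X where X: "X \<in> vtree_sets T"
    "\<And>A. A \<in> vtree_sets T \<Longrightarrow> card (cut \<phi> A) \<le> card (cut \<phi> X)"
    using exists_max_on[OF finite_vtree_sets[of T], of "\<lambda>A. card (cut \<phi> A)"] by blast
  have "cut \<phi> X \<subseteq> \<phi>" by (auto simp: cut_def)
  then obtain I where I: "I \<subseteq> cut \<phi> X" "scattered \<phi> I" "card (cut \<phi> X) \<le> card I * c ^ 4"
    using exists_scattered[OF fin\<phi> finK ne cardK degv] by blast
  have "tw \<phi> \<le> (3 * card (cut \<phi> X) + 1) * c"
    by (rule treewidth_le_cut[OF nf over cardK X(2)])
  also have "\<dots> \<le> (3 * (card I * c ^ 4) + 1) * c"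
    using I(3) by (intro mult_le_mono1 add_le_mono1 mult_le_mono2)
  finally show thesis using that X(1) I(1,2) by blast
qed

lemma circuit_size_ge_gates: "card (gates C) \<le> circuit_size C"
  by (simp add: circuit_size_def)

text \<open>Complementing a valuation turns the CNF into the negated DNF with the same clauses. The
  valuation \<nu> \<open>S\<close> falsifies the part in \<open>X\<close> of the clauses in
  \<open>S\<close> and the part outside of those not in \<open>S\<close>, so that mixing it with
  \<nu> \<open>S'\<close> leaves a model iff \<open>S \<subseteq> S'\<close>. For distinct sets one
  of the two inclusions fails.\<close>

lemma sdnnf_for_cnf_lower_bound:
  assumes nf: "monotone_nf \<phi>" and sd: "sdnnf C" and str: "structures T C" and cnf: "circuit_for_cnf C \<phi>"
    and X: "X \<in> vtree_sets T" and I: "I \<subseteq> cut \<phi> X" "scattered \<phi> I"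
  shows "2 ^ card I \<le> circuit_size C"
proof -
  have "finite \<phi>" using nf finite_UnionD by (auto simp: monotone_nf_def)
  then have finI: "finite I" using I(1) finite_subset[of I \<phi>] by (auto simp: cut_def)
  have I\<phi>: "I \<subseteq> \<phi>" and Xcut: "\<And>K. K \<in> I \<Longrightarrow> K \<inter> X \<noteq> {} \<and> \<not> K \<subseteq> X"
    using I(1) by (auto simp: cut_def)
  define \<nu> where "\<nu> S = mix X (\<lambda>z. z \<notin> \<Union>S) (\<lambda>z. z \<notin> \<Union>(I - S))" for S
  have val_iff: "circuit_value C (mix X (\<nu> S) (\<nu> S')) \<longleftrightarrow> S \<subseteq> S'" if "S \<in> Pow I" "S' \<in> Pow I" for S S'
  proof -
    have "circuit_value C (mix X (\<nu> S) (\<nu> S')) \<longleftrightarrow>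
        \<not> dnf_fun \<phi> (\<lambda>z. \<not> mix X (\<nu> S) (\<nu> S') z)"
      using cnf by (simp add: circuit_for_cnf_def cnf_fun_def dnf_fun_def)
    also have "(\<lambda>z. \<not> mix X (\<nu> S) (\<nu> S') z) = (\<lambda>z. if z \<in> X then z \<in> \<Union>S else z \<in> \<Union>(I - S'))"
      by (simp add: fun_eq_iff mix_def \<nu>_def)
    also have "dnf_fun \<phi> \<dots> \<longleftrightarrow> S \<inter> (I - S') \<noteq> {}"
      using that by (intro scattered_dnf_fun[OF nf I\<phi> I(2) Xcut]) auto
    finally show ?thesis using that by auto
  qed
  have self: "mix X (\<nu> S) (\<nu> S) = \<nu> S" for S by (simp add: mix_def)
  have "card (Pow I) \<le> card (gates C)"
  proof (rule fooling_set_bound[OF sd str X, where \<nu> = \<nu>])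
    show "circuit_value C (\<nu> S)" if "S \<in> Pow I" for S using val_iff[OF that that] self by simp
    show "\<not> circuit_value C (mix X (\<nu> S) (\<nu> S')) \<or> \<not> circuit_value C (mix X (\<nu> S') (\<nu> S))"
      if "S \<in> Pow I" "S' \<in> Pow I" "S \<noteq> S'" for S S'
      using val_iff[OF that(1,2)] val_iff[OF that(2,1)] that(3) by auto
  qed
  then show ?thesis using finI circuit_size_ge_gates[of C] by (simp add: card_Pow)
qed

text \<open>The restricted DNF tells whether two subsets of \<open>I\<close> intersect; subtracting
  it from the constant function 1 gives the disjointness matrix. This constant is the one generator
  that does not come from a gate, whence \<open>+ 1\<close>.\<close>

lemma d_sdnnf_for_dnf_lower_bound:
  assumes nf: "monotone_nf \<phi>" and ds: "d_sdnnf C" and str: "structures T C" and dnf: "circuit_for_dnf C \<phi>"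
    and X: "X \<in> vtree_sets T" and I: "I \<subseteq> cut \<phi> X" "scattered \<phi> I"
  shows "2 ^ card I \<le> circuit_size C + 1"
proof -
  have nnf: "nnf C" and det: "deterministic C" using ds by (auto simp: d_sdnnf_def sdnnf_def)
  have fin: "finite (gates C)" and out: "output_gate C \<in> gates C"
    using nnf by (auto simp: nnf_def circuit_def)
  have "finite \<phi>" using nf finite_UnionD by (auto simp: monotone_nf_def)
  then have finI: "finite I" using I(1) finite_subset[of I \<phi>] by (auto simp: cut_def)
  have I\<phi>: "I \<subseteq> \<phi>" and Xcut: "\<And>K. K \<in> I \<Longrightarrow> K \<inter> X \<noteq> {} \<and> \<not> K \<subseteq> X"
    using I(1) by (auto simp: cut_def)
  define U :: "'a \<Rightarrow> ('a \<Rightarrow> bool) \<Rightarrow> real" where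
    "U = (\<lambda>h \<mu>. of_bool (gate_value C (mix X \<mu> (\<lambda>_. False)) h))"
  define W where "W = insert (\<lambda>_. 1) (U ` gates C)"
  define F :: "'a clauses \<Rightarrow> ('a \<Rightarrow> bool) \<Rightarrow> real" where
    "F S' = (\<lambda>_. 1) - (\<lambda>\<mu>. of_bool (circuit_value C (mix X \<mu> (\<lambda>z. z \<in> \<Union>S'))))" for S'
  have "2 ^ card I \<le> card W"
  proof (rule disjointness_rank[where F = F and x = "\<lambda>S z. z \<in> \<Union>S", OF finI])
    show "finite W" using fin by (simp add: W_def)
    show "F S' \<in> fun_space.span W" for S'
      using gate_value_in_span[OF nnf str det X out, folded U_def, folded W_def] fun_space.span_base[of "\<lambda>_. 1" W]
      unfolding F_def circuit_value_def by (intro fun_space.span_diff) (auto simp: W_def)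
    show "F S' (\<lambda>z. z \<in> \<Union>S) = of_bool (S \<inter> S' = {})" if "S \<subseteq> I" "S' \<subseteq> I" for S S'
    proof -
      have "circuit_value C (mix X (\<lambda>z. z \<in> \<Union>S) (\<lambda>z. z \<in> \<Union>S')) \<longleftrightarrow> S \<inter> S' \<noteq> {}"
        unfolding mix_def using dnf scattered_dnf_fun[OF nf I\<phi> I(2) Xcut that]
        by (simp add: circuit_for_dnf_def)
      then show ?thesis unfolding F_def by simp
    qed
  qed
  also have "\<dots> \<le> card (gates C) + 1"
    unfolding W_def using card_image_le[OF fin, of U] by (simp add: card_insert_if fin)
  finally show ?thesis using circuit_size_ge_gates[of C] by linarith
qed

text \<open>Up to the factor \<open>d ^ 5\<close>, the assumptions say
  \<open>12 \<le> t \<le> 3 * k + 1\<close>. So \<open>k\<close> is at least 4 and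
  \<open>3 * k + 1 \<le> 12 * (k - 1)\<close>. The exponent \<open>k - 1\<close> instead of
  \<open>k\<close> pays for the additive 1 in \<open>2 ^ k \<le> n + 1\<close>, because
  \<open>n + 1 \<le> 2 * n\<close>.\<close>

lemma treewidth_exponent:
  fixes d k t :: nat
  assumes t: "t \<le> (3 * (k * d ^ 4) + 1) * d" and large: "12 * d ^ 5 \<le> t" and d: "d \<ge> 1"
  shows "1 / (12 * real d ^ 5) * real t \<le> real k - 1"
proof -
  have "d \<le> d ^ 5" using d by (simp add: self_le_power)
  moreover have "(3 * (k * d ^ 4) + 1) * d = 3 * k * d ^ 5 + d" by (simp add: numeral_eq_Suc algebra_simps)
  ultimately have "t \<le> 3 * k * d ^ 5 + d ^ 5" using t by linarith
  then have "real t \<le> 3 * real k * real d ^ 5 + real d ^ 5"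
    using of_nat_mono[of t "3 * k * d ^ 5 + d ^ 5", where 'a = real] by simp
  moreover have "12 * real d ^ 5 \<le> real t"
    using of_nat_mono[OF large, where 'a = real] by simp
  ultimately have "real t \<le> (real k - 1) * (12 * real d ^ 5)" by (simp add: algebra_simps)
  moreover have "12 * real d ^ 5 > 0" using d by simp
  ultimately show ?thesis by (simp add: pos_divide_le_eq)
qed

lemma two_powr_le_of_exponent:
  assumes "x \<le> real k - 1" "2 ^ k \<le> n + 1" "n \<ge> 1"
  shows "2 powr x \<le> real n"
proof -
  have "2 powr x \<le> 2 powr (real k - 1)" using assms(1) by simp
  also have "\<dots> = 2 ^ k / 2" by (simp add: powr_diff powr_realpow)
  also have "\<dots> \<le> real n"
    using of_nat_mono[OF assms(2), where 'a = real] assms(3) by simp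
  finally show ?thesis .
qed

text \<open>\<open>63 * 2 \<le> 2 ^ 7\<close>, and \<open>7 + t \<le> 8 * t\<close> once
  \<open>t \<ge> 1\<close>; this is the origin of the exponent factor 8 and of the threshold
  1.\<close>

lemma upper_bound_arith:
  assumes "m \<le> 63 * 2 ^ (t + 1) * n" "t \<ge> 1"
  shows "real m \<le> real n * 2 powr (8 * real t)"
proof -
  have "63 * 2 ^ (t + 1) \<le> (2 :: nat) ^ 7 * 2 ^ t" by simp
  also have "\<dots> = 2 ^ (7 + t)" by (simp only: power_add)
  also have "\<dots> \<le> 2 ^ (8 * t)" using assms(2) by (intro power_increasing) auto
  finally have "m \<le> 2 ^ (8 * t) * n" using assms(1) by (meson le_trans mult_le_mono1)
  then have "real m \<le> real (2 ^ (8 * t) * n)" by (rule of_nat_mono)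
  also have "\<dots> = real n * 2 powr (8 * real t)"
    using powr_realpow[of 2 "8 * t"] by simp
  finally show ?thesis .
qed

lemma circuit_size_pos: "circuit C \<Longrightarrow> circuit_size C \<ge> 1"
  by (auto simp: circuit_def circuit_size_def Suc_le_eq card_gt_0_iff)

theorem corollary26:
  fixes c :: nat
  shows
   "((\<exists>(a::real) (k0::nat). \<forall>\<phi> :: 'v::infinite clauses.
        monotone_nf \<phi> \<and> arity \<phi> \<le> c \<and> degree \<phi> \<le> c \<and> tw \<phi> \<ge> k0 \<longrightarrow>
        (\<exists>C. d_sdnnf C \<and> circuit_for_dnf C \<phi> \<and>
             real (circuit_size C) \<le> real (formula_size \<phi>) * 2 powr (a * real (tw \<phi>))))
   \<and> (\<exists>(b::real) (k0::nat). b > 0 \<and> (\<forall>\<phi> :: 'v clauses.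
        monotone_nf \<phi> \<and> arity \<phi> \<le> c \<and> degree \<phi> \<le> c \<and> tw \<phi> \<ge> k0 \<longrightarrow>
        (\<forall>C. d_sdnnf C \<and> circuit_for_dnf C \<phi> \<longrightarrow>
             2 powr (b * real (tw \<phi>)) \<le> real (circuit_size C)))))
  \<and> ((\<exists>(a::real) (k0::nat). \<forall>\<phi> :: 'v clauses.
        monotone_nf \<phi> \<and> arity \<phi> \<le> c \<and> degree \<phi> \<le> c \<and> tw \<phi> \<ge> k0 \<longrightarrow>
        (\<exists>C. d_sdnnf C \<and> circuit_for_cnf C \<phi> \<and>
             real (circuit_size C) \<le> real (formula_size \<phi>) * 2 powr (a * real (tw \<phi>))))
   \<and> (\<exists>(b::real) (k0::nat). b > 0 \<and> (\<forall>\<phi> :: 'v clauses.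
        monotone_nf \<phi> \<and> arity \<phi> \<le> c \<and> degree \<phi> \<le> c \<and> tw \<phi> \<ge> k0 \<longrightarrow>
        (\<forall>C. sdnnf C \<and> circuit_for_cnf C \<phi> \<longrightarrow>
             2 powr (b * real (tw \<phi>)) \<le> real (circuit_size C)))))"
proof (intro conjI)
  \<comment> \<open>The shift keeps \<open>?b\<close> positive for \<open>c = 0\<close>, where
    division by zero would make it 0.\<close>
  define d where "d = Suc c"
  have d: "d \<ge> 1" "c \<le> d" by (simp_all add: d_def)
  let ?b = "1 / (12 * real d ^ 5)"
  have b: "?b > 0" using d by simp
  show "\<exists>(a::real) (k0::nat). \<forall>\<phi> :: 'v clauses.
        monotone_nf \<phi> \<and> arity \<phi> \<le> c \<and> degree \<phi> \<le> c \<and> tw \<phi> \<ge> k0 \<longrightarrow>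
        (\<exists>C. d_sdnnf C \<and> circuit_for_dnf C \<phi> \<and>
             real (circuit_size C) \<le> real (formula_size \<phi>) * 2 powr (a * real (tw \<phi>)))"
  proof (intro exI[of _ "8::real"] exI[of _ "1::nat"] allI impI, elim conjE)
    fix \<phi> :: "'v clauses" assume nf: "monotone_nf \<phi>" and tw: "tw \<phi> \<ge> 1"
    obtain C where C: "d_sdnnf C" "var_gates C = \<Union>\<phi>"
      "\<forall>\<nu>. circuit_value C \<nu> \<longleftrightarrow> True = (\<exists>K \<in> \<phi>. \<forall>x \<in> K. \<nu> x = True)"
      "circuit_size C \<le> 63 * 2 ^ (tw \<phi> + 1) * formula_size \<phi>"
      using exists_d_sdnnf_of_treewidth[OF nf, of True True] by (elim exE conjE)
    then have "circuit_for_dnf C \<phi>" by (simp add: circuit_for_dnf_def dnf_fun_def)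
    with C(1) upper_bound_arith[OF C(4) tw] show "\<exists>C. d_sdnnf C \<and> circuit_for_dnf C \<phi> \<and>
             real (circuit_size C) \<le> real (formula_size \<phi>) * 2 powr (8 * real (tw \<phi>))" by blast
  qed
  show "\<exists>(b::real) (k0::nat). b > 0 \<and> (\<forall>\<phi> :: 'v clauses.
        monotone_nf \<phi> \<and> arity \<phi> \<le> c \<and> degree \<phi> \<le> c \<and> tw \<phi> \<ge> k0 \<longrightarrow>
        (\<forall>C. d_sdnnf C \<and> circuit_for_dnf C \<phi> \<longrightarrow>
             2 powr (b * real (tw \<phi>)) \<le> real (circuit_size C)))"
  proof (intro exI[of _ ?b] exI[of _ "12 * d ^ 5"] conjI b allI impI, elim conjE)
    fix \<phi> :: "'v clauses" and C
    assume \<phi>: "monotone_nf \<phi>" "arity \<phi> \<le> c" "degree \<phi> \<le> c" "12 * d ^ 5 \<le> tw \<phi>"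
      and C: "d_sdnnf C" "circuit_for_dnf C \<phi>"
    have circ: "circuit C" using C(1) by (simp add: d_sdnnf_def sdnnf_def nnf_def)
    obtain T where T: "structures T C" using C(1) by (auto simp: d_sdnnf_def sdnnf_def)
    then have over: "vtree_over T (\<Union>\<phi>)" using C(2) by (simp add: structures_def circuit_for_dnf_def)
    obtain X I where XI: "X \<in> vtree_sets T" "I \<subseteq> cut \<phi> X" "scattered \<phi> I"
      "tw \<phi> \<le> (3 * (card I * d ^ 4) + 1) * d"
      using exists_scattered_cut[OF \<phi>(1) le_trans[OF \<phi>(2) d(2)] le_trans[OF \<phi>(3) d(2)] over] by blast
    show "2 powr (?b * real (tw \<phi>)) \<le> real (circuit_size C)"
      by (rule two_powr_le_of_exponent[OF treewidth_exponent[OF XI(4) \<phi>(4) d(1)]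
            d_sdnnf_for_dnf_lower_bound[OF \<phi>(1) C(1) T C(2) XI(1-3)] circuit_size_pos[OF circ]])
  qed
  show "\<exists>(a::real) (k0::nat). \<forall>\<phi> :: 'v clauses.
        monotone_nf \<phi> \<and> arity \<phi> \<le> c \<and> degree \<phi> \<le> c \<and> tw \<phi> \<ge> k0 \<longrightarrow>
        (\<exists>C. d_sdnnf C \<and> circuit_for_cnf C \<phi> \<and>
             real (circuit_size C) \<le> real (formula_size \<phi>) * 2 powr (a * real (tw \<phi>)))"
  proof (intro exI[of _ "8::real"] exI[of _ "1::nat"] allI impI, elim conjE)
    fix \<phi> :: "'v clauses" assume nf: "monotone_nf \<phi>" and tw: "tw \<phi> \<ge> 1"
    \<comment> \<open>A CNF holds iff no clause has all its variables false, so both the searched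
      value \<open>s\<close> and the claimed answer \<open>q\<close> are
      \<open>False\<close>.\<close>
    obtain C where C: "d_sdnnf C" "var_gates C = \<Union>\<phi>"
      "\<forall>\<nu>. circuit_value C \<nu> \<longleftrightarrow> False = (\<exists>K \<in> \<phi>. \<forall>x \<in> K. \<nu> x = False)"
      "circuit_size C \<le> 63 * 2 ^ (tw \<phi> + 1) * formula_size \<phi>"
      using exists_d_sdnnf_of_treewidth[OF nf, of False False] by (elim exE conjE)
    then have "circuit_for_cnf C \<phi>" by (simp add: circuit_for_cnf_def cnf_fun_def)
    with C(1) upper_bound_arith[OF C(4) tw] show "\<exists>C. d_sdnnf C \<and> circuit_for_cnf C \<phi> \<and>
             real (circuit_size C) \<le> real (formula_size \<phi>) * 2 powr (8 * real (tw \<phi>))" by blast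
  qed
  show "\<exists>(b::real) (k0::nat). b > 0 \<and> (\<forall>\<phi> :: 'v clauses.
        monotone_nf \<phi> \<and> arity \<phi> \<le> c \<and> degree \<phi> \<le> c \<and> tw \<phi> \<ge> k0 \<longrightarrow>
        (\<forall>C. sdnnf C \<and> circuit_for_cnf C \<phi> \<longrightarrow>
             2 powr (b * real (tw \<phi>)) \<le> real (circuit_size C)))"
  proof (intro exI[of _ ?b] exI[of _ "12 * d ^ 5"] conjI b allI impI, elim conjE)
    fix \<phi> :: "'v clauses" and C
    assume \<phi>: "monotone_nf \<phi>" "arity \<phi> \<le> c" "degree \<phi> \<le> c" "12 * d ^ 5 \<le> tw \<phi>"
      and C: "sdnnf C" "circuit_for_cnf C \<phi>"
    have circ: "circuit C" using C(1) by (simp add: sdnnf_def nnf_def)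
    obtain T where T: "structures T C" using C(1) by (auto simp: sdnnf_def)
    then have over: "vtree_over T (\<Union>\<phi>)" using C(2) by (simp add: structures_def circuit_for_cnf_def)
    obtain X I where XI: "X \<in> vtree_sets T" "I \<subseteq> cut \<phi> X" "scattered \<phi> I"
      "tw \<phi> \<le> (3 * (card I * d ^ 4) + 1) * d"
      using exists_scattered_cut[OF \<phi>(1) le_trans[OF \<phi>(2) d(2)] le_trans[OF \<phi>(3) d(2)] over] by blast
    show "2 powr (?b * real (tw \<phi>)) \<le> real (circuit_size C)"
      by (rule two_powr_le_of_exponent[OF treewidth_exponent[OF XI(4) \<phi>(4) d(1)]
            trans_le_add1[OF sdnnf_for_cnf_lower_bound[OF \<phi>(1) C(1) T C(2) XI(1-3)]] circuit_size_pos[OF circ]])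
  qed
qed

end
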